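(* Let $t_0\ge 0$ and let $a,b,g,h:[0,\infty)\to\mathbb R$ be Lebesgue measurable functions such that $a,b$ are essentially bounded on $[0,\infty)$; $\operatorname{ess\,sup}_{t\ge t_0}|a(t)|\le a_0$ for some constant $a_0<1$; $b(t)\ge 0$; $g(t)\le t$, $h(t)\le t$, $\lim_{t\to\infty}g(t)=\lim_{t\to\infty}h(t)=\infty$; the set $g^{-1}(E)$ has Lebesgue measure zero whenever $E$ has Lebesgue measure zero; and $t-g(t)\le\delta$, $t-h(t)\le\tau$ for $t\ge t_0$ with some constants $\delta>0$, $\tau>0$. Assume that there is a constant $b_0$ such that for all $t\ge t_0$ $$0<b_0\le b(t),\qquad \int_{h(t)}^t b(s)\,ds\le \frac1e,$$ and that $$\|a\|_{[t_0,\infty)}+\|b\|_{[t_0,\infty)}\left\|\frac{a}{b}\right\|_{[t_0,\infty)}<1.$$ Then the equation $\dot x(t)-a(t)\dot x(g(t))+b(t)x(h(t))=0$ is exponentially stable.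
   Context: Notation: $\|f\|_{[t_0,\infty)}=\operatorname{ess\,sup}_{t\ge t_0}|f(t)|$. In integrals over $[h(t),t]$ the coefficient $b$ is taken to be $0$ at negative arguments. Solutions: for an initial point $\sigma\ge 0$ and bounded Borel measurable functions $\varphi:(-\infty,\sigma]\to\mathbb R$, $\psi:(-\infty,\sigma)\to\mathbb R$, a solution of the initial value problem for the equation is a function $x:\mathbb R\to\mathbb R$ that is absolutely continuous on each interval $[\sigma,c]$, satisfies the equation for almost all $t\in[\sigma,\infty)$, and satisfies the initial conditions $x(t)=\varphi(t)$ for $t\le\sigma$, $\dot x(t)=\psi(t)$ for $t<\sigma$ (these give the values of $x$ and $\dot x$ used in the equation at such arguments). The equation is (uniformly) exponentially stable if there exist $M>0$, $\gamma>0$, not depending on $\sigma\ge 0$, $\varphi$, $\psi$, such that the solution of the initial value problem satisfies $|x(t)|\le M e^{-\gamma(t-\sigma)}\sup_{s\le\sigma}(|\varphi(s)|+|\psi(s)|)$ for $t\ge\sigma$ (with $\psi(\sigma):=0$).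
   Formalization: Stability is uniform over initial points σ≥t_0, and over all σ≥0 only if also |a|≤a_0 a.e. on [0,∞) (false otherwise when t_0>0); solutions must also have derivative essentially bounded on bounded intervals, since merely absolutely continuous solutions are not unique. *)

theory Defs
  imports "HOL-Analysis.Analysis" "HOL-Probability.Essential_Supremum"
begin

text \<open>
  The value is in \<^typ>\<open>ereal\<close>, so \<^prop>\<open>ess_norm t\<^sub>0 f < \<infinity>\<close> says that \<^term>\<open>f\<close> is essentially
  bounded on \<open>[t\<^sub>0, \<infinity>)\<close>.
\<close>

definition ess_norm :: "real \<Rightarrow> (real \<Rightarrow> real) \<Rightarrow> ereal" where
  "ess_norm t\<^sub>0 f = esssup (lebesgue_on {t\<^sub>0..}) (\<lambda>t. ereal \<bar>f t\<bar>)"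

text \<open>
  Absolute continuity of a function; the library constant \<^const>\<open>absolutely_continuous\<close> is about
  measures. A division of a subset of \<open>{u..v}\<close> is a finite family of nonoverlapping compact
  intervals contained in \<open>{u..v}\<close>.
\<close>

definition absolutely_continuous_fun :: "real \<Rightarrow> real \<Rightarrow> (real \<Rightarrow> real) \<Rightarrow> bool" where
  "absolutely_continuous_fun u v f \<longleftrightarrow>
     (\<forall>\<epsilon>>0. \<exists>\<delta>>0. \<forall>D S. D division_of S \<and> S \<subseteq> {u..v} \<and> (\<Sum>K\<in>D. Sup K - Inf K) < \<delta>
        \<longrightarrow> (\<Sum>K\<in>D. \<bar>f (Sup K) - f (Inf K)\<bar>) < \<epsilon>)"

text \<open>
  The derivative that enters the neutral term: before the initial point it is prescribed by
  \<open>\<psi>\<close>, and is not the derivative of the initial function.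
\<close>

definition neutral_deriv :: "real \<Rightarrow> (real \<Rightarrow> real) \<Rightarrow> (real \<Rightarrow> real) \<Rightarrow> real \<Rightarrow> real" where
  "neutral_deriv \<sigma> \<psi> x s = (if s < \<sigma> then \<psi> s else deriv x s)"

definition initial_data :: "real \<Rightarrow> (real \<Rightarrow> real) \<Rightarrow> (real \<Rightarrow> real) \<Rightarrow> bool" where
  "initial_data \<sigma> \<phi> \<psi> \<longleftrightarrow>
     \<phi> \<in> borel_measurable (restrict_space borel {..\<sigma>}) \<and> bounded (\<phi> ` {..\<sigma>}) \<and>
     \<psi> \<in> borel_measurable (restrict_space borel {..<\<sigma>}) \<and> bounded (\<psi> ` {..<\<sigma>})"

text \<open>
  Solutions of \<open>x'(t) - a(t) x'(g(t)) + b(t) x(h(t)) = 0\<close> with initial point \<open>\<sigma>\<close>. The derivative is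
  required to be essentially bounded on bounded intervals, because this is the class in which one
  can speak of \<^emph>\<open>the\<close> solution: with merely absolutely continuous functions the initial value problem
  is not uniquely solvable. For \<open>a = 1/4\<close>, \<open>g(t) = t/16\<close> near \<open>0\<close>, \<open>h(t) = t\<close>, constant \<open>b\<close>, \<open>\<sigma> = 0\<close>
  and zero initial data there is a nonzero absolutely continuous solution
  \<open>x(t) = t powr (1/2) + \<dots>\<close> besides \<open>x = 0\<close>.
\<close>

definition solution ::
    "(real \<Rightarrow> real) \<Rightarrow> (real \<Rightarrow> real) \<Rightarrow> (real \<Rightarrow> real) \<Rightarrow> (real \<Rightarrow> real) \<Rightarrow>
     real \<Rightarrow> (real \<Rightarrow> real) \<Rightarrow> (real \<Rightarrow> real) \<Rightarrow> (real \<Rightarrow> real) \<Rightarrow> bool" where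
  "solution a b g h \<sigma> \<phi> \<psi> x \<longleftrightarrow>
     (\<forall>c. absolutely_continuous_fun \<sigma> c x) \<and>
     (\<forall>c. \<exists>K. AE t in lebesgue_on {\<sigma>..c}. \<bar>deriv x t\<bar> \<le> K) \<and>
     (AE t in lebesgue_on {\<sigma>..}. x differentiable (at t) \<and>
        deriv x t - a t * neutral_deriv \<sigma> \<psi> x (g t) + b t * x (h t) = 0) \<and>
     (\<forall>t\<le>\<sigma>. x t = \<phi> t)"

text \<open>
  Uniform exponential stability with respect to all initial points \<open>\<sigma> \<ge> s\<close>; for \<open>s = 0\<close> this is
  uniform exponential stability with respect to all initial points of the half-line. The initial
  derivative \<open>\<psi>\<close> is given on \<open>(-\<infinity>, \<sigma>)\<close> only and is taken to be \<open>0\<close> at \<open>\<sigma>\<close> in the supremum.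
\<close>

definition exponentially_stable_from ::
    "real \<Rightarrow> (real \<Rightarrow> real) \<Rightarrow> (real \<Rightarrow> real) \<Rightarrow> (real \<Rightarrow> real) \<Rightarrow> (real \<Rightarrow> real) \<Rightarrow> bool" where
  "exponentially_stable_from s a b g h \<longleftrightarrow>
     (\<exists>M>0. \<exists>\<gamma>>0. \<forall>\<sigma>\<ge>s. \<forall>\<phi> \<psi> x.
        initial_data \<sigma> \<phi> \<psi> \<and> solution a b g h \<sigma> \<phi> \<psi> x \<longrightarrow>
        (\<forall>t\<ge>\<sigma>. \<bar>x t\<bar> \<le> M * exp (- \<gamma> * (t - \<sigma>)) *
           (SUP r\<in>{..\<sigma>}. \<bar>\<phi> r\<bar> + (if r < \<sigma> then \<bar>\<psi> r\<bar> else 0))))"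

end

theory Submission
  imports Defs
begin

text \<open>
  The nonneutral inequality \<open>w' + b w(h) \<ge> 0\<close> preserves nonnegativity when \<open>\<integral> b \<le> 1/e\<close> over each delay
  interval. Applied to \<open>w = K exp (- \<nu> (t - \<sigma>)) \<plusminus> x\<close>, this bounds the weighted norm of a solution of
  \<open>x' + b x(h) = f\<close> by that of \<open>f / b\<close>. For \<open>f = a x'(g)\<close> it gives \<open>|x| \<lesssim> \<parallel>a/b\<parallel> |x'|\<close>, and the equation
  itself gives \<open>|x'| \<lesssim> \<parallel>a\<parallel> |x'| + \<parallel>b\<parallel> |x|\<close>, with initial terms and with factors that tend to \<open>1\<close> as
  \<open>\<nu> \<rightarrow> 0\<close>. Since \<open>\<parallel>a\<parallel> + \<parallel>b\<parallel> \<parallel>a/b\<parallel> < 1\<close>, the essential bound of the weighted \<open>x'\<close> closes up for some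
  \<open>\<nu> > 0\<close>. For initial points before \<open>t\<^sub>0\<close>, a growth estimate carries the initial bound over to \<open>t\<^sub>0\<close>.
\<close>

section \<open>Absolutely continuous functions\<close>

text \<open>The number 1/e enters through the comparison function \<open>E\<close>, the exponential
  of minus e times the integral of \<open>b\<close> (with e = exp 1). Its relative rate of decrease
  is e \<open>b\<close>, and over a delay interval it loses at most the factor exp (e / e) = e, so
  that E' + b E(h) \<le> 0. A rate c in place of e would need exp (c / e) \<le> c, which holds for c
  = e alone. The obstacle is that x' is both unknown and part of the forcing, so x cannot be bounded
  first. The least essential bound U of the weighted derivative over a finite interval is therefore
  treated as an unknown number: x is bounded affinely in U, the equation returns U \<le> q U + c1 M
  with q < 1, and U may be moved to the left because it is finite, the derivative of a solution
  being locally essentially bounded. The outcome no longer depends on the length of the interval.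
  Bounds on x' hold only almost everywhere; they pass to x'(g) because preimages of null sets under
  g are null.\<close>

text \<open>Members of a division overlap only in null sets, so their lengths add up to the measure
  of the union. This turns a small open cover into the small total length that absolute continuity
  asks for.\<close>

lemma sum_content_division_le_measure:
  fixes D :: "real set set"
  assumes D: "D division_of S" and SU: "S \<subseteq> U" and U: "U \<in> lmeasurable"
  shows "sum (measure lborel) D \<le> measure lebesgue U"
proof -
  have "S \<in> lmeasurable"
    using D by (metis lmeasurable_compact elementary_bounded compact_eq_bounded_closed division_ofD(4) division_ofD(1) division_ofD(6) closed_Union closed_cbox)
  have "((\<lambda>x. 1::real) has_integral (\<Sum>K\<in>D. measure lborel K)) S"
  proof (rule has_integral_combine_division[OF D])
    fix K assume "K \<in> D"
    then obtain a b where "K = cbox a b" using D by blast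
    then show "((\<lambda>x. 1::real) has_integral measure lborel K) K"
      using has_integral_const[of "1::real" a b] by simp
  qed
  then have "sum (measure lborel) D = measure lebesgue S"
    by (metis \<open>S \<in> lmeasurable\<close> integral_unique lmeasure_integral)
  also have "\<dots> \<le> measure lebesgue U"
    using \<open>S \<in> lmeasurable\<close> SU U by (simp add: measure_mono_fmeasurable fmeasurableD)
  finally show ?thesis .
qed

text \<open>The fundamental theorem of calculus in gauge form: intervals tagged at points of
  differentiability are handled by linear approximation, those tagged in the exceptional set by
  absolute continuity. Integrability of \<open>f'\<close> is a result here, not an
  assumption.\<close>

theorem absolutely_continuous_fun_has_integral_deriv:
  fixes f f' :: "real \<Rightarrow> real"
  assumes "u \<le> v" and ac: "absolutely_continuous_fun u v f" and N: "negligible N"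
    and f': "\<And>t. t \<in> {u..v} - N \<Longrightarrow> (f has_real_derivative f' t) (at t within {u..v})"
  shows "(f' has_integral (f v - f u)) {u..v}"
proof -
  \<comment> \<open>With the integrand 0 on \<open>N\<close>, a tag in \<open>N\<close> contributes
    only an increment of \<open>f\<close>.\<close>
  define F where "F t = (if t \<in> N then 0 else f' t)" for t
  have "(F has_integral (f v - f u)) {u..v}"
    unfolding has_integral_real
  proof (intro allI impI)
    fix e :: real assume "e > 0"
    \<comment> \<open>The summand 1 keeps the denominator positive when
      \<open>u = v\<close>.\<close>
    define e1 where "e1 = e / 2 / (v - u + 1)"
    have "e1 > 0" using \<open>e > 0\<close> \<open>u \<le> v\<close> by (simp add: e1_def)
    have "\<exists>d>0. x \<in> {u..v} - N \<longrightarrow> (\<forall>y\<in>{u..v}. \<bar>y - x\<bar> < d \<longrightarrow> \<bar>f y - f x - f' x * (y - x)\<bar> \<le> e1 * \<bar>y - x\<bar>)" for x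
    proof (cases "x \<in> {u..v} - N")
      case True
      then have "(f has_derivative (*) (f' x)) (at x within {u..v})"
        using f' by (simp add: has_field_derivative_def)
      then show ?thesis
        using \<open>e1 > 0\<close> unfolding has_derivative_within_alt by (auto simp: real_norm_def)
    qed (use zero_less_one in blast)
    then obtain d where d0: "\<And>x. d x > 0"
      and d: "\<And>x y. x \<in> {u..v} - N \<Longrightarrow> y \<in> {u..v} \<Longrightarrow> \<bar>y - x\<bar> < d x \<Longrightarrow> \<bar>f y - f x - f' x * (y - x)\<bar> \<le> e1 * \<bar>y - x\<bar>"
      by metis
    obtain \<delta> where "\<delta> > 0" and \<delta>: "\<And>D S. D division_of S \<Longrightarrow> S \<subseteq> {u..v} \<Longrightarrow> (\<Sum>K\<in>D. Sup K - Inf K) < \<delta>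
        \<Longrightarrow> (\<Sum>K\<in>D. \<bar>f (Sup K) - f (Inf K)\<bar>) < e / 2"
      using ac \<open>e > 0\<close> unfolding absolutely_continuous_fun_def by (meson half_gt_zero)
    have "N \<in> sets lebesgue" "emeasure lebesgue N = 0"
      using N negligible_iff_null_sets null_setsD2 null_setsD1 by blast+
    then obtain T where T: "open T" "N \<subseteq> T" "T - N \<in> lmeasurable" "emeasure lebesgue (T - N) < ennreal \<delta>"
      using sets_lebesgue_outer_open[OF _ \<open>\<delta> > 0\<close>] by metis
    have "T = (T - N) \<union> N" using T(2) by blast
    then have Tm: "T \<in> lmeasurable" "measure lebesgue T = measure lebesgue (T - N)"
      using N T(3) by (metis fmeasurable.Un negligible_imp_measurable, metis N measure_Un_null_set T(3) fmeasurableD negligible_iff_null_sets)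
    have "measure lebesgue T < \<delta>"
      using T(3,4) Tm(2) \<open>\<delta> > 0\<close> by (metis emeasure_eq_measure2 ennreal_less_iff measure_nonneg)
    \<comment> \<open>All tags in \<open>N\<close> share the open set \<open>T\<close> of measure
      below \<open>\<delta>\<close>, so the intervals tagged there have total length below
      \<open>\<delta>\<close>.\<close>
    define \<gamma> where "\<gamma> x = (if x \<in> N then T else ball x (d x))" for x
    have "gauge \<gamma>" unfolding gauge_def \<gamma>_def using T d0 by auto
    moreover have "norm ((\<Sum>(x, K)\<in>p. measure lborel K *\<^sub>R F x) - (f v - f u)) < e"
      if p: "p tagged_division_of {u..v}" and fine: "\<gamma> fine p" for p
    proof -
      let ?h = "\<lambda>(x, K). measure lborel K * F x - (f (Sup K) - f (Inf K))"
      have fin: "finite p" using p by blast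
      have K: "\<exists>l r. K = {l..r} \<and> l \<le> x \<and> x \<le> r \<and> u \<le> l \<and> r \<le> v \<and> K \<subseteq> \<gamma> x" if "(x, K) \<in> p" for x K
      proof -
        obtain l r where "K = {l..r}" using tagged_division_ofD(4)[OF p \<open>(x, K) \<in> p\<close>] by auto
        moreover have "x \<in> K" "K \<subseteq> {u..v}" using tagged_division_ofD(2,3)[OF p \<open>(x, K) \<in> p\<close>] by auto
        moreover have "K \<subseteq> \<gamma> x" using fine \<open>(x, K) \<in> p\<close> by blast
        ultimately show ?thesis by auto
      qed
      have "(\<Sum>(x, K)\<in>p. measure lborel K *\<^sub>R F x) - (f v - f u) = sum ?h p"
        unfolding additive_tagged_division_1[OF \<open>u \<le> v\<close> p, symmetric]
        by (simp add: sum_subtractf[symmetric] split_def)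
      also have "\<dots> = sum ?h {z\<in>p. fst z \<notin> N} + sum ?h {z\<in>p. fst z \<in> N}"
        by (subst sum.union_disjoint[symmetric]) (use fin in \<open>auto intro!: sum.cong\<close>)
      finally have split: "(\<Sum>(x, K)\<in>p. measure lborel K *\<^sub>R F x) - (f v - f u) = \<dots>" .
      have "\<bar>sum ?h {z\<in>p. fst z \<notin> N}\<bar> \<le> (\<Sum>(x, K)\<in>{z\<in>p. fst z \<notin> N}. e1 * (Sup K - Inf K))"
      proof (rule order_trans[OF sum_abs sum_mono], clarify)
        fix x K assume "(x, K) \<in> p" and x: "fst (x, K) \<notin> N"
        then obtain l r where lr: "K = {l..r}" "l \<le> x" "x \<le> r" "u \<le> l" "r \<le> v" "K \<subseteq> \<gamma> x" using K by blast
        then have "l \<in> K" "r \<in> K" "K \<subseteq> ball x (d x)"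
          using x by (simp_all add: \<gamma>_def)
        then have "l \<in> ball x (d x)" "r \<in> ball x (d x)" by blast+
        then have b: "\<bar>l - x\<bar> < d x" "\<bar>r - x\<bar> < d x"
          by (auto simp: dist_real_def)
        have "\<bar>f r - f x - f' x * (r - x)\<bar> \<le> e1 * \<bar>r - x\<bar>" "\<bar>f l - f x - f' x * (l - x)\<bar> \<le> e1 * \<bar>l - x\<bar>"
          using d[of x r] d[of x l] lr x b by auto
        \<comment> \<open>The increment over [l, r] is split at the tag \<open>x\<close> between the
          end points; the two errors then add up to at most \<open>e1 * (r - l)\<close>.\<close>
        moreover have "(r - l) * f' x - (f r - f l) = (f l - f x - f' x * (l - x)) - (f r - f x - f' x * (r - x))"
          by (simp add: algebra_simps)
        moreover have "e1 * \<bar>r - x\<bar> + e1 * \<bar>l - x\<bar> = e1 * (r - l)"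
          using lr by (simp add: algebra_simps)
        ultimately have "\<bar>(r - l) * f' x - (f r - f l)\<bar> \<le> e1 * (r - l)" by linarith
        then show "\<bar>measure lborel K * F x - (f (Sup K) - f (Inf K))\<bar> \<le> e1 * (Sup K - Inf K)"
          using lr x by (simp add: F_def)
      qed
      also have "\<dots> \<le> (\<Sum>(x, K)\<in>p. e1 * (Sup K - Inf K))"
        using fin K \<open>e1 > 0\<close> by (intro sum_mono2) fastforce+
      also have "\<dots> = e1 * (v - u)"
        using additive_tagged_division_1[OF \<open>u \<le> v\<close> p, of "\<lambda>x. x"]
        by (simp add: sum_distrib_left[symmetric] split_def)
      also have "\<dots> \<le> e / 2"
        using \<open>e > 0\<close> \<open>u \<le> v\<close> by (simp add: e1_def field_simps)
      finally have 1: "\<bar>sum ?h {z\<in>p. fst z \<notin> N}\<bar> \<le> e / 2" .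
      let ?q = "{z\<in>p. fst z \<in> N}" and ?D = "snd ` {z\<in>p. fst z \<in> N}"
      have q: "?q tagged_partial_division_of {u..v}"
        using p unfolding tagged_division_of_def by (auto elim: tagged_partial_division_subset)
      have D: "?D division_of \<Union>?D" by (rule partial_division_of_tagged_division[OF q])
      have DT: "\<Union>?D \<subseteq> T" using K by (fastforce simp: \<gamma>_def)
      have Duv: "\<Union>?D \<subseteq> {u..v}" using K by fastforce
      have cont: "measure lborel K = Sup K - Inf K" if "K \<in> ?D" for K using that K by fastforce
      have "(\<Sum>K\<in>?D. Sup K - Inf K) = sum (measure lborel) ?D"
        by (rule sum.cong) (simp_all add: cont)
      also have "\<dots> \<le> measure lebesgue T"
        using D DT Tm(1) by (rule sum_content_division_le_measure)
      finally have "(\<Sum>K\<in>?D. \<bar>f (Sup K) - f (Inf K)\<bar>) < e / 2"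
        using \<delta>[OF D Duv] \<open>measure lebesgue T < \<delta>\<close> by linarith
      moreover have "(\<Sum>(x, K)\<in>?q. \<bar>f (Sup K) - f (Inf K)\<bar>) = (\<Sum>K\<in>?D. \<bar>f (Sup K) - f (Inf K)\<bar>)"
      proof -
        \<comment> \<open>Passing from tagged pairs to intervals needs a function that vanishes on
          every box with empty interior. The empty box is one of them, and it gets the value 0 by
          definition because \<open>Sup\<close> and \<open>Inf\<close> are of no use there.\<close>
        define \<Delta> where "\<Delta> K = (if K = {} then 0 else \<bar>f (Sup K) - f (Inf K)\<bar>)" for K
        have \<Delta>: "\<Delta> K = \<bar>f (Sup K) - f (Inf K)\<bar>" if "(x, K) \<in> p" for x K
          using K[OF that] by (auto simp: \<Delta>_def)
        have "(\<Sum>(x, K)\<in>?q. \<Delta> K) = (\<Sum>K\<in>?D. \<Delta> K)"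
        proof (rule sum.over_tagged_division_lemma[OF tagged_partial_division_of_Union_self[OF q]])
          fix l r :: real assume "box l r = {}"
          then consider "r < l" | "l = r" by fastforce
          then show "\<Delta> (cbox l r) = 0"
            by cases (simp_all add: \<Delta>_def)
        qed
        moreover have "(\<Sum>(x, K)\<in>?q. \<Delta> K) = (\<Sum>(x, K)\<in>?q. \<bar>f (Sup K) - f (Inf K)\<bar>)"
          by (rule sum.cong) (use \<Delta> in auto)
        moreover have "(\<Sum>K\<in>?D. \<Delta> K) = (\<Sum>K\<in>?D. \<bar>f (Sup K) - f (Inf K)\<bar>)"
          by (rule sum.cong) (use \<Delta> in auto)
        ultimately show ?thesis by simp
      qed
      moreover have "\<bar>sum ?h ?q\<bar> \<le> (\<Sum>(x, K)\<in>?q. \<bar>f (Sup K) - f (Inf K)\<bar>)"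
        by (rule order_trans[OF sum_abs sum_mono]) (auto simp: F_def)
      ultimately show ?thesis
        using 1 unfolding split real_norm_def by argo
    qed
    ultimately show "\<exists>\<gamma>. gauge \<gamma> \<and> (\<forall>\<D>. \<D> tagged_division_of {u..v} \<and> \<gamma> fine \<D> \<longrightarrow>
        norm ((\<Sum>(x, K)\<in>\<D>. measure lborel K *\<^sub>R F x) - (f v - f u)) < e)"
      by (metis (no_types))
  qed
  then show ?thesis
    by (rule has_integral_spike[OF N, rotated]) (auto simp: F_def)
qed

section \<open>Positivity for the delay inequality\<close>

text \<open>The chain rule for \<open>E\<close>, stated for increments: the comparison argument uses
  nothing else about \<open>E\<close>, and this form holds for bounded integrable \<open>b\<close>
  without pointwise derivatives of its integral.\<close>

lemma has_integral_exp_neg_integral: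
  fixes b :: "real \<Rightarrow> real"
  assumes "c \<ge> 0" and int: "b integrable_on {\<sigma>..T}"
    and b: "\<And>t. t \<in> {\<sigma>..T} \<Longrightarrow> 0 \<le> b t \<and> b t \<le> \<beta>"
    and st: "\<sigma> \<le> s" "s \<le> t" "t \<le> T"
  defines "E \<equiv> \<lambda>t. exp (- c * integral {\<sigma>..t} b)"
  shows "((\<lambda>r. - c * b r * E r) has_integral (E t - E s)) {s..t}"
proof -
  have "\<beta> \<ge> 0" using b[of s] st by auto
  have int': "b integrable_on {l..r}" if "\<sigma> \<le> l" "r \<le> T" for l r
    using integrable_subinterval_real[OF int, of l r] that by auto
  have B: "integral {\<sigma>..r} b = integral {\<sigma>..l} b + integral {l..r} b" if "\<sigma> \<le> l" "l \<le> r" "r \<le> T" for l r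
    using Henstock_Kurzweil_Integration.integral_combine[OF that(1,2) int'] that by simp
  have B0: "0 \<le> integral {l..r} b \<and> integral {l..r} b \<le> \<beta> * (r - l)" if "\<sigma> \<le> l" "l \<le> r" "r \<le> T" for l r
  proof
    show "0 \<le> integral {l..r} b" using that b int' by (intro integral_nonneg) auto
    have "integral {l..r} b \<le> integral {l..r} (\<lambda>_. \<beta>)"
      using that b int' by (intro integral_le) auto
    then show "integral {l..r} b \<le> \<beta> * (r - l)" using that by (simp add: mult.commute)
  qed
  have mono: "E r \<le> E l" if "\<sigma> \<le> l" "l \<le> r" "r \<le> T" for l r
    using B[OF that] B0[OF that] \<open>c \<ge> 0\<close> by (simp add: E_def mult_left_mono)
  have E1: "0 < E r \<and> E r \<le> 1" if "\<sigma> \<le> r" "r \<le> T" for r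
    using mono[of \<sigma> r] that by (simp add: E_def)
  have contB: "continuous_on {\<sigma>..T} (\<lambda>t. integral {\<sigma>..t} b)"
    by (rule indefinite_integral_continuous_1[OF int])
  then have contE: "continuous_on {\<sigma>..T} E" unfolding E_def by (intro continuous_intros)
  have intbE: "(\<lambda>r. b r * E r) integrable_on {\<sigma>..T}"
  proof -
    have "b absolutely_integrable_on {\<sigma>..T}"
      using int b by (intro nonnegative_absolutely_integrable_1) auto
    moreover have "bounded (E ` {\<sigma>..T})"
      using contE compact_continuous_image compact_imp_bounded by blast
    ultimately have "(\<lambda>r. E r * b r) absolutely_integrable_on {\<sigma>..T}"
      using contE by (intro absolutely_integrable_bounded_measurable_product_real
          continuous_imp_measurable_on_sets_lebesgue) auto
    then show ?thesis by (simp add: mult.commute set_lebesgue_integral_eq_integral(1))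
  qed
  have intbE': "(\<lambda>r. b r * E r) integrable_on {l..r}" if "\<sigma> \<le> l" "r \<le> T" for l r
    using integrable_subinterval_real[OF intbE, of l r] that by auto
  have intb_const: "(\<lambda>x. b x * y) integrable_on {l..r}" if "\<sigma> \<le> l" "r \<le> T" for l r y
    using int'[OF that] by (rule integrable_on_mult_left)
  define F where "F r = E r + c * integral {\<sigma>..r} (\<lambda>r. b r * E r)" for r
  \<comment> \<open>The integral of \<open>b\<close> need not be differentiable everywhere, but the increments of \<open>F\<close> are quadratically small.\<close>
  have key: "\<bar>F r - F l\<bar> \<le> (c * \<beta>)\<^sup>2 * (r - l)\<^sup>2" if lr: "\<sigma> \<le> l" "l \<le> r" "r \<le> T" for l r
  proof -
    define D where "D = c * integral {l..r} b"
    define I where "I = c * integral {l..r} (\<lambda>r. b r * E r)"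
    have D: "0 \<le> D" "D \<le> c * \<beta> * (r - l)"
      using B0[OF lr] \<open>c \<ge> 0\<close> mult_left_mono[of "integral {l..r} b" "\<beta> * (r - l)" c] by (auto simp: D_def mult.assoc)
    have Er: "E r = E l * exp (- D)"
      unfolding E_def B[OF lr] D_def by (simp add: exp_add[symmetric] algebra_simps)
    have "integral {l..r} (\<lambda>x. b x * E x) \<le> integral {l..r} (\<lambda>x. b x * E l)"
      using lr b mono intbE' intb_const by (intro integral_le) (auto intro!: mult_left_mono)
    then have I1: "I \<le> D * E l"
      using \<open>c \<ge> 0\<close> mult_left_mono[OF _ \<open>c \<ge> 0\<close>] by (fastforce simp: D_def I_def mult.assoc)
    have "integral {l..r} (\<lambda>x. b x * E r) \<le> integral {l..r} (\<lambda>x. b x * E x)"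
      using lr b mono intbE' intb_const by (intro integral_le) (auto intro!: mult_left_mono)
    then have I2: "D * E r \<le> I"
      using \<open>c \<ge> 0\<close> mult_left_mono[OF _ \<open>c \<ge> 0\<close>] by (fastforce simp: D_def I_def mult.assoc)
    have "1 - D \<le> exp (- D)" using exp_ge_add_one_self[of "- D"] by simp
    then have "E l * (1 - D) \<le> E r" unfolding Er using E1[of l] lr by (intro mult_left_mono) auto
    then have E2: "E l - E r \<le> D * E l" by (simp add: algebra_simps)
    have El: "E l = E r * exp D" unfolding Er by (simp add: exp_minus)
    have "1 + D \<le> exp D" by (rule exp_ge_add_one_self)
    then have "E r * (1 + D) \<le> E l" unfolding El using E1[of r] lr by (intro mult_left_mono) auto
    then have E3: "D * E r \<le> E l - E r" by (simp add: algebra_simps)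
    have "integral {\<sigma>..r} (\<lambda>x. b x * E x) = integral {\<sigma>..l} (\<lambda>x. b x * E x) + integral {l..r} (\<lambda>x. b x * E x)"
      using Henstock_Kurzweil_Integration.integral_combine[OF lr(1,2) intbE'] lr by simp
    \<comment> \<open>Monotonicity of \<open>E\<close> places \<open>I\<close> between
      \<open>D * E r\<close> and \<open>D * E l\<close>, and the tangent bounds for exp place
      \<open>E l - E r\<close> in the same interval. Hence they differ by at most its length
      \<open>D * (E l - E r)\<close>, a product of two factors of order
      \<open>r - l\<close>.\<close>
    then have "F r - F l = I - (E l - E r)" by (simp add: F_def I_def algebra_simps)
    also have "\<bar>\<dots>\<bar> \<le> D * (E l - E r)" using I1 I2 E2 E3 by (simp add: algebra_simps abs_le_iff)
    also have "\<dots> \<le> D * (D * 1)"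
      using E2 D(1) E1[of l] lr by (intro mult_left_mono order_trans[OF E2]) auto
    also have "\<dots> \<le> (c * \<beta> * (r - l)) * (c * \<beta> * (r - l))"
      using D power_mono[OF D(2,1), of 2] by (simp only: power2_eq_square mult_1_right)
    finally show ?thesis by (simp add: power2_eq_square algebra_simps)
  qed
  have "(F has_derivative (\<lambda>h. 0)) (at x within {\<sigma>..T})" if x: "x \<in> {\<sigma>..T}" for x
    unfolding has_derivative_within_alt
  proof (intro conjI allI impI bounded_linear_zero)
    fix e :: real assume "e > 0"
    let ?d = "e / ((c * \<beta>)\<^sup>2 + 1)"
    have "?d > 0" using \<open>e > 0\<close> by (simp add: add_nonneg_pos)
    moreover have "norm (F y - F x - 0) \<le> e * norm (y - x)" if y: "y \<in> {\<sigma>..T}" "norm (y - x) < ?d" for y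
    proof -
      have "\<bar>F y - F x\<bar> \<le> (c * \<beta>)\<^sup>2 * (y - x)\<^sup>2"
        using key[of x y] key[of y x] x y(1) by (cases "x \<le> y") (auto simp: power2_commute abs_minus_commute)
      also have "\<dots> = ((c * \<beta>)\<^sup>2 * \<bar>y - x\<bar>) * \<bar>y - x\<bar>" by (simp add: power2_eq_square)
      also have "\<dots> \<le> e * \<bar>y - x\<bar>"
      proof (rule mult_right_mono)
        have "(c * \<beta>)\<^sup>2 * \<bar>y - x\<bar> \<le> ((c * \<beta>)\<^sup>2 + 1) * \<bar>y - x\<bar>" by (simp add: algebra_simps)
        also have "\<dots> \<le> e" using y(2) by (simp add: add_nonneg_pos pos_less_divide_eq mult.commute)
        finally show "(c * \<beta>)\<^sup>2 * \<bar>y - x\<bar> \<le> e" .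
      qed simp
      finally show ?thesis by simp
    qed
    ultimately show "\<exists>d>0. \<forall>y\<in>{\<sigma>..T}. norm (y - x) < d \<longrightarrow> norm (F y - F x - 0) \<le> e * norm (y - x)"
      by blast
  qed
  then obtain k where "\<And>x. x \<in> {\<sigma>..T} \<Longrightarrow> F x = k"
    using has_derivative_zero_constant[of "{\<sigma>..T}" F] by auto
  then have "F t = F s" using st by auto
  moreover have "integral {\<sigma>..t} (\<lambda>x. b x * E x) = integral {\<sigma>..s} (\<lambda>x. b x * E x) + integral {s..t} (\<lambda>x. b x * E x)"
    using Henstock_Kurzweil_Integration.integral_combine[OF st(1,2) intbE'] st by simp
  ultimately have "E t - E s = - c * integral {s..t} (\<lambda>x. b x * E x)"
    by (simp add: F_def algebra_simps)
  moreover have "((\<lambda>r. - c * (b r * E r)) has_integral (- c * integral {s..t} (\<lambda>x. b x * E x))) {s..t}"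
    using intbE'[of s t] st by (intro has_integral_mult_right integrable_integral) auto
  ultimately show ?thesis by (simp add: mult.assoc)
qed

lemma has_integral_nonneg_negligible:
  fixes f :: "real \<Rightarrow> real"
  assumes "(f has_integral i) S" "negligible N" "\<And>x. x \<in> S - N \<Longrightarrow> 0 \<le> f x"
  shows "0 \<le> i"
proof (rule has_integral_nonneg)
  show "((\<lambda>x. if x \<in> N then 0 else f x) has_integral i) S"
    by (rule has_integral_spike[OF assms(2) _ assms(1)]) auto
qed (use assms(3) in auto)

text \<open>\<open>E\<close> is a positive function with E' + b E(h) \<le> 0, whereas w' + b w(h)
  \<ge> 0. With \<open>m\<close> the maximum of \<open>w / E\<close>, the upper bound
  \<open>w\<close> \<le> \<open>m E\<close> at the delayed argument becomes a lower bound for w'.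
  Thus a maximum of the quotient, not a first zero of \<open>w\<close>, drives the proof. Arguments
  before \<sigma> are replaced by \<sigma>, so only values on the interval matter.\<close>

lemma delay_inequality_nonneg:
  fixes w w' b h E :: "real \<Rightarrow> real"
  assumes "\<sigma> \<le> T"
    and w: "\<And>s t. \<sigma> \<le> s \<Longrightarrow> s \<le> t \<Longrightarrow> t \<le> T \<Longrightarrow> (w' has_integral (w t - w s)) {s..t}"
    and E: "\<And>s t. \<sigma> \<le> s \<Longrightarrow> s \<le> t \<Longrightarrow> t \<le> T \<Longrightarrow> ((\<lambda>r. - c * b r * E r) has_integral (E t - E s)) {s..t}"
    and E0: "\<And>t. t \<in> {\<sigma>..T} \<Longrightarrow> 0 < E t"
    and N: "negligible N"
    and ineq: "\<And>t. t \<in> {\<sigma>..T} - N \<Longrightarrow>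
      0 \<le> b t \<and> h t \<le> t \<and> E (max \<sigma> (h t)) \<le> c * E t \<and> 0 \<le> w' t + b t * w (max \<sigma> (h t))"
    and "0 \<le> w \<sigma>"
  shows "0 \<le> w T"
proof -
  have cont: "continuous_on {\<sigma>..T} f" if f: "\<And>s t. \<sigma> \<le> s \<Longrightarrow> s \<le> t \<Longrightarrow> t \<le> T \<Longrightarrow> (f' has_integral (f t - f s)) {s..t}"
    for f f' :: "real \<Rightarrow> real"
  proof -
    have "continuous_on {\<sigma>..T} (\<lambda>t. f \<sigma> + integral {\<sigma>..t} f')"
      using f[of \<sigma> T] \<open>\<sigma> \<le> T\<close> by (intro continuous_intros indefinite_integral_continuous_1) auto
    then show ?thesis
      by (rule continuous_on_eq) (use f in \<open>force dest: integral_unique\<close>)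
  qed
  have "continuous_on {\<sigma>..T} (\<lambda>t. w t / E t)"
    using cont[OF w] cont[OF E] E0 by (intro continuous_on_divide) force+
  then obtain s where s: "s \<in> {\<sigma>..T}" and max: "\<And>t. t \<in> {\<sigma>..T} \<Longrightarrow> w t / E t \<le> w s / E s"
    using continuous_attains_sup[of "{\<sigma>..T}" "\<lambda>t. w t / E t"] \<open>\<sigma> \<le> T\<close> by auto
  define m where "m = w s / E s"
  have "m \<ge> 0"
    using max[of \<sigma>] E0[of \<sigma>] \<open>0 \<le> w \<sigma>\<close> \<open>\<sigma> \<le> T\<close> unfolding m_def
    by (meson atLeastAtMost_iff divide_nonneg_pos order_refl order_trans)
  have le: "w t \<le> m * E t" if "t \<in> {\<sigma>..T}" for t
    using max[OF that] E0[OF that] unfolding m_def[symmetric] by (simp add: pos_divide_le_eq)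
  \<comment> \<open>\<open>w - m E\<close> vanishes at \<open>s\<close> and is nondecreasing from there on.\<close>
  have "((\<lambda>r. w' r - m * (- c * b r * E r)) has_integral ((w T - w s) - m * (E T - E s))) {s..T}"
    using s by (intro has_integral_diff has_integral_mult_right w E) auto
  moreover have "0 \<le> w' r - m * (- c * b r * E r)" if r: "r \<in> {s..T} - N" for r
  proof -
    have r': "r \<in> {\<sigma>..T} - N" using r s by auto
    have "b r * w (max \<sigma> (h r)) \<le> b r * (m * E (max \<sigma> (h r)))"
      using ineq[OF r'] r' by (intro mult_left_mono le) auto
    also have "\<dots> \<le> b r * (m * (c * E r))"
      using ineq[OF r'] \<open>m \<ge> 0\<close> by (intro mult_left_mono) auto
    finally show ?thesis using ineq[OF r'] by (simp add: algebra_simps)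
  qed
  ultimately have "0 \<le> (w T - w s) - m * (E T - E s)"
    by (rule has_integral_nonneg_negligible[OF _ N])
  moreover have "w s = m * E s" using E0[OF s] by (simp add: m_def)
  ultimately have "m * E T \<le> w T" by (simp add: algebra_simps)
  moreover have "0 \<le> m * E T" using \<open>m \<ge> 0\<close> E0[of T] \<open>\<sigma> \<le> T\<close> by (simp add: less_imp_le)
  ultimately show ?thesis by linarith
qed

lemma has_integral_exp_linear:
  fixes c :: real
  assumes "s \<le> t"
  shows "((\<lambda>r. c * exp (c * (r - \<sigma>))) has_integral (exp (c * (t - \<sigma>)) - exp (c * (s - \<sigma>)))) {s..t}"
  by (rule fundamental_theorem_of_calculus[OF assms])
    (auto intro!: derivative_eq_intros simp: has_real_derivative_iff_has_vector_derivative[symmetric])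

text \<open>The barriers \<open>K e - x\<close> and \<open>K e + x\<close> satisfy the delay
  inequality. The condition on \<open>K\<close> collects the costs, each divided by
  \<open>b\<close>: \<open>F\<close> for the forcing, \<open>2 * M\<close> for reading
  \<open>x\<close> at \<sigma> instead of at an earlier argument, and the fraction
  \<open>\<nu> / b\<^sub>0\<close> of \<open>K\<close> for the decay of the barrier itself.\<close>

lemma delay_equation_exp_bound:
  fixes x x' b h :: "real \<Rightarrow> real"
  assumes "\<sigma> \<le> T" "0 \<le> \<nu>" "0 < b\<^sub>0" "0 \<le> F"
    and int: "b integrable_on {\<sigma>..T}"
    and b: "\<And>t. t \<in> {\<sigma>..T} \<Longrightarrow> 0 \<le> b t \<and> b t \<le> \<beta>"
    and h: "\<And>t. t \<in> {\<sigma>..T} \<Longrightarrow> h t \<le> t \<and> integral {max \<sigma> (h t)..t} b \<le> 1 / exp 1"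
    and x: "\<And>s t. \<sigma> \<le> s \<Longrightarrow> s \<le> t \<Longrightarrow> t \<le> T \<Longrightarrow> (x' has_integral (x t - x s)) {s..t}"
    and N: "negligible N"
    and eq: "\<And>t. t \<in> {\<sigma>..T} - N \<Longrightarrow>
      b\<^sub>0 \<le> b t \<and> \<bar>x' t + b t * x (h t)\<bar> \<le> b t * F * exp (- \<nu> * (t - \<sigma>))"
    and M: "\<And>s. s \<le> \<sigma> \<Longrightarrow> \<bar>x s\<bar> \<le> M" and "M \<le> K" and K: "F + 2 * M \<le> K * (1 - \<nu> / b\<^sub>0)"
  shows "\<bar>x T\<bar> \<le> K * exp (- \<nu> * (T - \<sigma>))"
proof -
  define E where "E t = exp (- exp 1 * integral {\<sigma>..t} b)" for t
  define e where "e t = exp (- \<nu> * (t - \<sigma>))" for t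
  have "0 \<le> M" using M[of \<sigma>] by simp
  then have "0 \<le> K" using \<open>M \<le> K\<close> by simp
  have E: "((\<lambda>r. - exp 1 * b r * E r) has_integral (E t - E s)) {s..t}" if "\<sigma> \<le> s" "s \<le> t" "t \<le> T" for s t
    unfolding E_def by (rule has_integral_exp_neg_integral[OF _ int b that]) auto
  have Eh: "E (max \<sigma> (h t)) \<le> exp 1 * E t" if t: "t \<in> {\<sigma>..T}" for t
  proof -
    have "integral {\<sigma>..t} b = integral {\<sigma>..max \<sigma> (h t)} b + integral {max \<sigma> (h t)..t} b"
      using h[OF t] t integrable_subinterval_real[OF int, of \<sigma> t]
      by (intro Henstock_Kurzweil_Integration.integral_combine[symmetric]) auto
    then have "integral {\<sigma>..t} b \<le> integral {\<sigma>..max \<sigma> (h t)} b + 1 / exp 1"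
      using h[OF t] by simp
    then have "exp 1 * integral {\<sigma>..t} b \<le> exp 1 * integral {\<sigma>..max \<sigma> (h t)} b + 1"
      by (simp add: field_simps)
    then show ?thesis unfolding E_def by (simp add: exp_add[symmetric])
  qed
  \<comment> \<open>The values 1 and -1 of \<open>c\<close> give the two one-sided bounds.\<close>
  have "0 \<le> K * e T - c * x T" if c: "\<bar>c\<bar> = 1" for c :: real
  proof (rule delay_inequality_nonneg[where w = "\<lambda>t. K * e t - c * x t"
        and w' = "\<lambda>t. K * (- \<nu> * e t) - c * x' t", OF \<open>\<sigma> \<le> T\<close> _ E _ N])
    fix s t assume "\<sigma> \<le> s" "s \<le> t" "t \<le> T"
    then have "((\<lambda>t. K * (- \<nu> * e t) - c * x' t) has_integral (K * (e t - e s) - c * (x t - x s))) {s..t}"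
      unfolding e_def by (intro has_integral_diff has_integral_mult_right has_integral_exp_linear x)
    then show "((\<lambda>t. K * (- \<nu> * e t) - c * x' t) has_integral (K * e t - c * x t - (K * e s - c * x s))) {s..t}"
      by (simp add: algebra_simps)
  next
    have "\<bar>c * x \<sigma>\<bar> \<le> K" using M[of \<sigma>] c \<open>M \<le> K\<close> by (simp add: abs_mult)
    then show "0 \<le> K * e \<sigma> - c * x \<sigma>" by (simp add: e_def abs_le_iff)
  next
    fix t assume "t \<in> {\<sigma>..T}"
    show "0 < E t" by (simp add: E_def)
  next
    fix t assume t: "t \<in> {\<sigma>..T} - N"
    have bt: "0 < b t" "b\<^sub>0 \<le> b t" using eq[OF t] \<open>0 < b\<^sub>0\<close> by auto
    have et: "0 < e t" "e t \<le> 1" using t \<open>0 \<le> \<nu>\<close> by (auto simp: e_def)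
    have "\<bar>c * (x' t + b t * x (h t))\<bar> \<le> b t * F * e t"
      using eq[OF t] c by (simp add: abs_mult e_def)
    then have f: "c * (x' t + b t * x (h t)) \<le> b t * F * e t" by (simp add: abs_le_iff)
    \<comment> \<open>The lower bound on \<open>b\<close> turns the derivative of the barrier into a
      multiple of \<open>b\<close>, so that all terms can be compared after division by
      \<open>b\<close>.\<close>
    have "\<nu> * b\<^sub>0 \<le> \<nu> * b t" using bt \<open>0 \<le> \<nu>\<close> by (intro mult_left_mono)
    then have "\<nu> \<le> b t * (\<nu> / b\<^sub>0)" using \<open>0 < b\<^sub>0\<close> by (simp add: field_simps)
    then have \<nu>: "\<nu> * K \<le> b t * (K * (\<nu> / b\<^sub>0))"
      using \<open>0 \<le> K\<close> mult_right_mono[of \<nu> "b t * (\<nu> / b\<^sub>0)" K] by (simp add: mult_ac)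
    have "b t * (F + 2 * M) \<le> b t * (K * (1 - \<nu> / b\<^sub>0))" using bt K by (intro mult_left_mono) auto
    then have main: "b t * F + 2 * (b t * M) + \<nu> * K \<le> b t * K"
      using \<nu> by (simp add: algebra_simps)
    have "0 \<le> K * (- \<nu> * e t) - c * x' t + b t * (K * e (max \<sigma> (h t)) - c * x (max \<sigma> (h t)))"
    proof (cases "\<sigma> \<le> h t")
      case True
      have "e t \<le> e (h t)"
        using h[of t] t \<open>0 \<le> \<nu>\<close> by (auto simp: e_def mult_left_mono)
      then have "b t * K * e t \<le> b t * K * e (h t)" using bt \<open>0 \<le> K\<close> by (intro mult_left_mono) auto
      moreover have "0 \<le> (b t * K - \<nu> * K - b t * F) * e t"
        using main et mult_nonneg_nonneg[of "b t" M] bt \<open>0 \<le> M\<close> by (intro mult_nonneg_nonneg) linarith+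
      ultimately show ?thesis using True f by (simp add: max_def algebra_simps)
    next
      case False
      \<comment> \<open>Here the barrier is evaluated at \<sigma>, while the equation contains the
        initial function at \<open>h t\<close>. Both values are at most \<open>M\<close> in modulus,
        and \<open>e \<sigma> = 1\<close> makes the barrier large enough to absorb the
        difference.\<close>
      have "\<bar>c * (x \<sigma> - x (h t))\<bar> \<le> 2 * M"
        using M[of \<sigma>] M[of "h t"] False c by (simp add: abs_mult)
      then have "b t * (c * (x \<sigma> - x (h t))) \<le> b t * (2 * M)"
        using bt by (intro mult_left_mono) auto
      moreover have "(b t * F + \<nu> * K) * e t \<le> b t * F + \<nu> * K"
        using et bt \<open>0 \<le> F\<close> \<open>0 \<le> \<nu>\<close> \<open>0 \<le> K\<close> by (intro mult_right_le_one_le) auto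
      moreover have "e \<sigma> = 1" by (simp add: e_def)
      ultimately show ?thesis using False f main by (simp add: max_def algebra_simps)
    qed
    then show "0 \<le> b t \<and> h t \<le> t \<and> E (max \<sigma> (h t)) \<le> exp 1 * E t \<and>
        0 \<le> K * (- \<nu> * e t) - c * x' t + b t * (K * e (max \<sigma> (h t)) - c * x (max \<sigma> (h t)))"
      using bt h[of t] t Eh[of t] by auto
  qed
  from this[of 1] this[of "- 1"] show ?thesis by (simp add: e_def abs_le_iff)
qed

text \<open>Used for \<^const>\<open>deriv\<close> in place of \<^const>\<open>esssup\<close>, whose value is \<open>\<infinity>\<close> on nonmeasurable functions.\<close>

lemma least_ess_bound:
  fixes f :: "'a \<Rightarrow> real"
  assumes K: "AE t in M. P t \<longrightarrow> \<bar>f t\<bar> \<le> K"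
  obtains U where "0 \<le> U" "AE t in M. P t \<longrightarrow> \<bar>f t\<bar> \<le> U"
    "\<And>K. 0 \<le> K \<Longrightarrow> AE t in M. P t \<longrightarrow> \<bar>f t\<bar> \<le> K \<Longrightarrow> U \<le> K"
proof
  define S where "S = {K. 0 \<le> K \<and> (AE t in M. P t \<longrightarrow> \<bar>f t\<bar> \<le> K)}"
  have "max 0 K \<in> S" unfolding S_def using K by (auto elim!: eventually_mono)
  moreover have bdd: "bdd_below S" unfolding S_def by (auto intro: bdd_belowI)
  ultimately show "0 \<le> Inf S" by (metis (no_types, lifting) S_def cInf_greatest empty_iff mem_Collect_eq)
  show "Inf S \<le> K" if "0 \<le> K" "AE t in M. P t \<longrightarrow> \<bar>f t\<bar> \<le> K" for K
    using that bdd by (intro cInf_lower) (auto simp: S_def)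
  have "AE t in M. P t \<longrightarrow> \<bar>f t\<bar> \<le> Inf S + 1 / real (Suc n)" for n
  proof -
    have "Inf S < Inf S + 1 / real (Suc n)" by simp
    then obtain K where "K \<in> S" "K < Inf S + 1 / real (Suc n)"
      using \<open>max 0 K \<in> S\<close> bdd by (metis cInf_less_iff empty_iff)
    then show ?thesis unfolding S_def by (auto elim!: eventually_mono)
  qed
  then have "AE t in M. \<forall>n. P t \<longrightarrow> \<bar>f t\<bar> \<le> Inf S + 1 / real (Suc n)"
    unfolding AE_all_countable by blast
  then show "AE t in M. P t \<longrightarrow> \<bar>f t\<bar> \<le> Inf S"
  proof (rule eventually_mono, intro impI)
    fix t assume t: "\<forall>n. P t \<longrightarrow> \<bar>f t\<bar> \<le> Inf S + 1 / real (Suc n)" "P t"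
    show "\<bar>f t\<bar> \<le> Inf S"
    proof (rule field_le_epsilon)
      fix e :: real assume "0 < e"
      then obtain n where "1 / real (Suc n) < e" using nat_approx_posE by blast
      then show "\<bar>f t\<bar> \<le> Inf S + e" using t by (meson add_left_mono less_imp_le order_trans)
    qed
  qed
qed

lemma AE_lebesgue_negligible:
  assumes "AE t in lebesgue. P t"
  obtains N where "negligible N" "\<And>t. t \<notin> N \<Longrightarrow> P t"
  using assms unfolding eventually_ae_filter negligible_iff_null_sets by auto

section \<open>Bounds for trajectories of the neutral equation\<close>

lemma abs_mult_exp_le_iff:
  fixes u z K :: real
  shows "\<bar>u * exp z\<bar> \<le> K \<longleftrightarrow> \<bar>u\<bar> \<le> K * exp (- z)"
  by (simp add: abs_mult exp_minus field_simps)

text \<open>A delay of at most \<delta> costs the factor \<open>exp (\<nu> * \<delta>)\<close> in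
  the weight. If \<open>g t\<close> lies before \<sigma>, then \<open>t\<close> is within \<delta>
  of \<sigma>, the weight times this factor is at least 1, and the constant \<open>M\<close> fits
  under it. Assumption \<open>pull\<close> makes the exceptional set of \<open>d\<close> harmless
  after composition with \<open>g\<close>.\<close>

lemma ess_bound_exp_decay_step:
  fixes d g :: "real \<Rightarrow> real"
  assumes pull: "\<And>P. (AE s in lebesgue. P s) \<Longrightarrow> (AE t in lebesgue. \<sigma> \<le> t \<longrightarrow> P (g t))"
    and g: "AE t in lebesgue. \<sigma> \<le> t \<longrightarrow> t - \<delta> \<le> g t \<and> g t \<le> t"
    and U: "AE s in lebesgue. \<sigma> \<le> s \<and> s \<le> T \<longrightarrow> \<bar>d s\<bar> \<le> U * exp (- \<nu> * (s - \<sigma>))"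
    and M: "AE s in lebesgue. s < \<sigma> \<longrightarrow> \<bar>d s\<bar> \<le> M"
    and "0 \<le> U" "0 \<le> M" "0 \<le> \<nu>"
  shows "AE t in lebesgue. \<sigma> \<le> t \<and> t \<le> T \<longrightarrow>
    \<bar>d (g t)\<bar> \<le> exp (\<nu> * \<delta>) * (U + M) * exp (- \<nu> * (t - \<sigma>))"
proof -
  have "AE s in lebesgue. (\<sigma> \<le> s \<and> s \<le> T \<longrightarrow> \<bar>d s\<bar> \<le> U * exp (- \<nu> * (s - \<sigma>))) \<and> (s < \<sigma> \<longrightarrow> \<bar>d s\<bar> \<le> M)"
    using U M by eventually_elim auto
  from pull[OF this] g show ?thesis
  proof eventually_elim
    case (elim t)
    show ?case
    proof
      assume t: "\<sigma> \<le> t \<and> t \<le> T"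
      have "\<nu> * (t - g t) \<le> \<nu> * \<delta>" using elim t \<open>0 \<le> \<nu>\<close> by (intro mult_left_mono) auto
      then have e: "exp (- \<nu> * (g t - \<sigma>)) \<le> exp (\<nu> * \<delta>) * exp (- \<nu> * (t - \<sigma>))"
        by (simp add: exp_add[symmetric] algebra_simps)
      show "\<bar>d (g t)\<bar> \<le> exp (\<nu> * \<delta>) * (U + M) * exp (- \<nu> * (t - \<sigma>))"
      proof (cases "\<sigma> \<le> g t")
        case True
        then have "\<bar>d (g t)\<bar> \<le> U * exp (- \<nu> * (g t - \<sigma>))" using elim t by auto
        also have "\<dots> \<le> (U + M) * (exp (\<nu> * \<delta>) * exp (- \<nu> * (t - \<sigma>)))"
          using e \<open>0 \<le> U\<close> \<open>0 \<le> M\<close> by (intro mult_mono) auto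
        finally show ?thesis by (simp add: mult_ac)
      next
        case False
        then have "\<bar>d (g t)\<bar> \<le> M * 1" using elim t by auto
        also have "1 \<le> exp (- \<nu> * (g t - \<sigma>))" using False \<open>0 \<le> \<nu>\<close> by (simp add: mult_nonneg_nonpos)
        then have "1 \<le> exp (\<nu> * \<delta>) * exp (- \<nu> * (t - \<sigma>))" using e by linarith
        then have "M * 1 \<le> (U + M) * (exp (\<nu> * \<delta>) * exp (- \<nu> * (t - \<sigma>)))"
          using \<open>0 \<le> U\<close> \<open>0 \<le> M\<close> by (intro mult_mono) auto
        finally show ?thesis by (simp add: mult_ac)
      qed
    qed
  qed
qed

text \<open>
  Before \<open>\<sigma>\<close> the derivative \<open>d\<close> is only bounded almost everywhere, so that a solution may be restarted
  at a later point.
\<close>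

definition neutral_trajectory ::
    "real \<Rightarrow> (real \<Rightarrow> real) \<Rightarrow> (real \<Rightarrow> real) \<Rightarrow> (real \<Rightarrow> real) \<Rightarrow> (real \<Rightarrow> real) \<Rightarrow>
     (real \<Rightarrow> real) \<Rightarrow> (real \<Rightarrow> real) \<Rightarrow> real \<Rightarrow> bool" where
  "neutral_trajectory \<sigma> a b g h x d M \<longleftrightarrow>
     (\<forall>s t. \<sigma> \<le> s \<and> s \<le> t \<longrightarrow> (d has_integral (x t - x s)) {s..t}) \<and>
     (AE t in lebesgue. \<sigma> \<le> t \<longrightarrow>
        d t - a t * d (g t) + b t * x (h t) = 0 \<and> g t \<le> t \<and> h t \<le> t) \<and>
     (\<forall>T. \<exists>K. AE t in lebesgue. \<sigma> \<le> t \<and> t \<le> T \<longrightarrow> \<bar>d t\<bar> \<le> K) \<and>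
     (\<forall>P. (AE s in lebesgue. P s) \<longrightarrow> (AE t in lebesgue. \<sigma> \<le> t \<longrightarrow> P (g t))) \<and>
     (\<forall>s\<le>\<sigma>. \<bar>x s\<bar> \<le> M) \<and> (AE s in lebesgue. s < \<sigma> \<longrightarrow> \<bar>d s\<bar> \<le> M)"

text \<open>The a priori estimate for the decay. \<open>C\<close> and \<nu> are chosen before the
  coefficients, the solution and the initial point, which is what makes the stability
  uniform.\<close>

lemma neutral_delay_exp_bound:
  fixes \<alpha> \<beta> A b\<^sub>0 \<delta> \<tau> :: real
  assumes c: "0 \<le> \<alpha>" "0 \<le> \<beta>" "0 \<le> A" "0 < b\<^sub>0" and less: "\<alpha> + \<beta> * A < 1"
  shows "\<exists>C>0. \<exists>\<nu>>0. \<forall>\<sigma> a b g h x d M.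
    neutral_trajectory \<sigma> a b g h x d M \<and> (\<forall>T. b integrable_on {\<sigma>..T}) \<and>
    (\<forall>t\<ge>\<sigma>. 0 \<le> b t \<and> b t \<le> \<beta> \<and> h t \<le> t \<and> integral {max \<sigma> (h t)..t} b \<le> 1 / exp 1) \<and>
    (AE t in lebesgue. \<sigma> \<le> t \<longrightarrow>
      b\<^sub>0 \<le> b t \<and> \<bar>a t\<bar> \<le> \<alpha> \<and> \<bar>a t\<bar> \<le> A * b t \<and> t - \<delta> \<le> g t \<and> t - \<tau> \<le> h t) \<longrightarrow>
    (\<forall>t\<ge>\<sigma>. \<bar>x t\<bar> \<le> C * M * exp (- \<nu> * (t - \<sigma>)))"
proof -
  \<comment> \<open>At \<nu> = 0 this expression is \<alpha> + \<beta> A < 1, so by continuity it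
    stays below 1 for some small positive \<nu>.\<close>
  have "((\<lambda>\<nu>. \<alpha> * exp (\<nu> * \<delta>) + \<beta> * exp (\<nu> * \<tau>) * A * exp (\<nu> * \<delta>) / (1 - \<nu> / b\<^sub>0)) \<longlongrightarrow>
      \<alpha> * exp (0 * \<delta>) + \<beta> * exp (0 * \<tau>) * A * exp (0 * \<delta>) / (1 - 0 / b\<^sub>0)) (at_right 0)"
    using \<open>0 < b\<^sub>0\<close> by (intro tendsto_intros) auto
  then have "eventually (\<lambda>\<nu>. \<alpha> * exp (\<nu> * \<delta>) + \<beta> * exp (\<nu> * \<tau>) * A * exp (\<nu> * \<delta>) / (1 - \<nu> / b\<^sub>0) < 1) (at_right 0)"
    using less by (intro order_tendstoD(2)) auto
  moreover have "eventually (\<lambda>\<nu>. 0 < \<nu> \<and> \<nu> < b\<^sub>0) (at_right 0)"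
    using \<open>0 < b\<^sub>0\<close> by (auto simp: eventually_at_right_field)
  ultimately have "eventually (\<lambda>\<nu>. \<alpha> * exp (\<nu> * \<delta>) + \<beta> * exp (\<nu> * \<tau>) * A * exp (\<nu> * \<delta>) / (1 - \<nu> / b\<^sub>0) < 1 \<and> 0 < \<nu> \<and> \<nu> < b\<^sub>0) (at_right 0)"
    by eventually_elim auto
  then obtain \<nu> where \<nu>: "\<alpha> * exp (\<nu> * \<delta>) + \<beta> * exp (\<nu> * \<tau>) * A * exp (\<nu> * \<delta>) / (1 - \<nu> / b\<^sub>0) < 1"
      "0 < \<nu>" "\<nu> < b\<^sub>0"
    using eventually_happens[of _ "at_right (0::real)"] by fastforce
  define \<rho> where "\<rho> = 1 - \<nu> / b\<^sub>0"
  have "0 < \<rho>" using \<nu> by (simp add: \<rho>_def)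
  define s where "s = exp (\<nu> * \<delta>)"
  define r where "r = exp (\<nu> * \<tau>)"
  have sr: "0 < s" "0 < r" by (auto simp: s_def r_def)
  \<comment> \<open>\<open>q\<close> and \<open>c1\<close> are the coefficients of \<open>U\<close>
    and \<open>M\<close> after \<open>K\<close> is inserted into the bound for the weighted
    derivative; \<open>C\<close> is then the factor of \<open>M\<close> in the resulting bound for
    \<open>K\<close>.\<close>
  define q where "q = \<alpha> * s + \<beta> * r * A * s / \<rho>"
  have "q < 1" using \<nu>(1) by (simp add: q_def s_def r_def \<rho>_def)
  define c1 where "c1 = \<alpha> * s + \<beta> * r * ((A * s + 2) / \<rho> + 1)"
  have "0 \<le> c1" using c sr \<open>0 < \<rho>\<close> by (simp add: c1_def)
  define C where "C = (A * s * (c1 / (1 - q) + 1) + 2) / \<rho> + 1"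
  have "0 < C" unfolding C_def using c sr \<open>0 < \<rho>\<close> \<open>0 \<le> c1\<close> \<open>q < 1\<close>
    by (intro add_nonneg_pos divide_nonneg_pos add_nonneg_nonneg mult_nonneg_nonneg) auto
  show ?thesis
  proof (rule exI[of _ C], rule conjI[OF \<open>0 < C\<close>], rule exI[of _ \<nu>], rule conjI[OF \<open>0 < \<nu>\<close>],
      intro allI impI)
    fix a b g h x d :: "real \<Rightarrow> real" and \<sigma> M T :: real
    assume hyps: "neutral_trajectory \<sigma> a b g h x d M \<and> (\<forall>T. b integrable_on {\<sigma>..T}) \<and>
      (\<forall>t\<ge>\<sigma>. 0 \<le> b t \<and> b t \<le> \<beta> \<and> h t \<le> t \<and> integral {max \<sigma> (h t)..t} b \<le> 1 / exp 1) \<and>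
      (AE t in lebesgue. \<sigma> \<le> t \<longrightarrow>
        b\<^sub>0 \<le> b t \<and> \<bar>a t\<bar> \<le> \<alpha> \<and> \<bar>a t\<bar> \<le> A * b t \<and> t - \<delta> \<le> g t \<and> t - \<tau> \<le> h t)"
      and "\<sigma> \<le> T"
    then have int: "\<And>T. b integrable_on {\<sigma>..T}"
      and b: "\<And>t. \<sigma> \<le> t \<Longrightarrow> 0 \<le> b t \<and> b t \<le> \<beta> \<and> h t \<le> t \<and> integral {max \<sigma> (h t)..t} b \<le> 1 / exp 1"
      and x: "\<And>s t. \<sigma> \<le> s \<Longrightarrow> s \<le> t \<Longrightarrow> (d has_integral (x t - x s)) {s..t}"
      and bdd: "\<And>T. \<exists>K. AE t in lebesgue. \<sigma> \<le> t \<and> t \<le> T \<longrightarrow> \<bar>d t\<bar> \<le> K"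
      and pull: "\<And>P. (AE s in lebesgue. P s) \<Longrightarrow> (AE t in lebesgue. \<sigma> \<le> t \<longrightarrow> P (g t))"
      and M: "\<And>s. s \<le> \<sigma> \<Longrightarrow> \<bar>x s\<bar> \<le> M"
      and dM: "AE s in lebesgue. s < \<sigma> \<longrightarrow> \<bar>d s\<bar> \<le> M"
      unfolding neutral_trajectory_def by simp_all
    have "AE t in lebesgue. \<sigma> \<le> t \<longrightarrow> d t - a t * d (g t) + b t * x (h t) = 0 \<and> g t \<le> t \<and> h t \<le> t"
      "AE t in lebesgue. \<sigma> \<le> t \<longrightarrow>
        b\<^sub>0 \<le> b t \<and> \<bar>a t\<bar> \<le> \<alpha> \<and> \<bar>a t\<bar> \<le> A * b t \<and> t - \<delta> \<le> g t \<and> t - \<tau> \<le> h t"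
      using hyps unfolding neutral_trajectory_def by blast+
    then have eq: "AE t in lebesgue. \<sigma> \<le> t \<longrightarrow> d t - a t * d (g t) + b t * x (h t) = 0 \<and>
        b\<^sub>0 \<le> b t \<and> \<bar>a t\<bar> \<le> \<alpha> \<and> \<bar>a t\<bar> \<le> A * b t \<and> t - \<delta> \<le> g t \<and> g t \<le> t \<and> t - \<tau> \<le> h t"
      by eventually_elim blast
    have "0 \<le> M" using M[of \<sigma>] by simp
    obtain K\<^sub>0 where K\<^sub>0: "AE t in lebesgue. \<sigma> \<le> t \<and> t \<le> T \<longrightarrow> \<bar>d t\<bar> \<le> K\<^sub>0" using bdd by blast
    \<comment> \<open>This bound depends on \<open>T\<close> and on the solution. It only ensures
      that the least bound \<open>U\<close> is finite and does not enter the final estimate.\<close>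
    have "AE t in lebesgue. \<sigma> \<le> t \<and> t \<le> T \<longrightarrow> \<bar>d t * exp (\<nu> * (t - \<sigma>))\<bar> \<le> \<bar>K\<^sub>0\<bar> * exp (\<nu> * (T - \<sigma>))"
      using K\<^sub>0
    proof eventually_elim
      case (elim t)
      then show ?case using \<open>0 < \<nu>\<close> by (auto simp: abs_mult intro!: mult_mono)
    qed
    then obtain U where "0 \<le> U"
      and U: "AE t in lebesgue. \<sigma> \<le> t \<and> t \<le> T \<longrightarrow> \<bar>d t * exp (\<nu> * (t - \<sigma>))\<bar> \<le> U"
      and least: "\<And>K. 0 \<le> K \<Longrightarrow> AE t in lebesgue. \<sigma> \<le> t \<and> t \<le> T \<longrightarrow> \<bar>d t * exp (\<nu> * (t - \<sigma>))\<bar> \<le> K \<Longrightarrow> U \<le> K"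
      by (rule least_ess_bound) blast
    have weight: "\<bar>d t * exp (\<nu> * (t - \<sigma>))\<bar> \<le> K \<longleftrightarrow> \<bar>d t\<bar> \<le> K * exp (- \<nu> * (t - \<sigma>))" for t K
      using abs_mult_exp_le_iff[of "d t" "\<nu> * (t - \<sigma>)" K] by simp
    have dg: "AE t in lebesgue. \<sigma> \<le> t \<and> t \<le> T \<longrightarrow> \<bar>d (g t)\<bar> \<le> s * (U + M) * exp (- \<nu> * (t - \<sigma>))"
      unfolding s_def
    proof (rule ess_bound_exp_decay_step[OF pull _ _ dM])
      show "AE t in lebesgue. \<sigma> \<le> t \<longrightarrow> t - \<delta> \<le> g t \<and> g t \<le> t"
        using eq by eventually_elim auto
      show "AE s in lebesgue. \<sigma> \<le> s \<and> s \<le> T \<longrightarrow> \<bar>d s\<bar> \<le> U * exp (- \<nu> * (s - \<sigma>))"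
        using U unfolding weight .
    qed (use \<open>0 \<le> U\<close> \<open>0 \<le> M\<close> \<open>0 < \<nu>\<close> in auto)
    define F where "F = A * s * (U + M)"
    define K where "K = (F + 2 * M) / \<rho> + M"
    have "0 \<le> F" using c sr \<open>0 \<le> U\<close> \<open>0 \<le> M\<close> by (simp add: F_def)
    have "M \<le> K" using \<open>0 \<le> F\<close> \<open>0 \<le> M\<close> \<open>0 < \<rho>\<close> by (simp add: K_def)
    have "0 \<le> K" using \<open>0 \<le> M\<close> \<open>M \<le> K\<close> by simp
    have "AE t in lebesgue. \<sigma> \<le> t \<and> t \<le> T \<longrightarrow> b\<^sub>0 \<le> b t \<and> \<bar>d t + b t * x (h t)\<bar> \<le> b t * F * exp (- \<nu> * (t - \<sigma>))"
      using eq dg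
    proof eventually_elim
      case (elim t)
      show ?case
      proof
        assume t: "\<sigma> \<le> t \<and> t \<le> T"
        then have "d t + b t * x (h t) = a t * d (g t)" using elim by auto
        then have "\<bar>d t + b t * x (h t)\<bar> = \<bar>a t\<bar> * \<bar>d (g t)\<bar>" by (simp add: abs_mult)
        also have "\<dots> \<le> (A * b t) * (s * (U + M) * exp (- \<nu> * (t - \<sigma>)))"
          using elim t c b[of t] by (intro mult_mono) auto
        finally show "b\<^sub>0 \<le> b t \<and> \<bar>d t + b t * x (h t)\<bar> \<le> b t * F * exp (- \<nu> * (t - \<sigma>))"
          using elim t by (simp add: F_def mult_ac)
      qed
    qed
    then obtain N where N: "negligible N"
      "\<And>t. t \<notin> N \<Longrightarrow> \<sigma> \<le> t \<and> t \<le> T \<longrightarrow> b\<^sub>0 \<le> b t \<and> \<bar>d t + b t * x (h t)\<bar> \<le> b t * F * exp (- \<nu> * (t - \<sigma>))"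
      by (rule AE_lebesgue_negligible) blast
    have xK: "\<bar>x t\<bar> \<le> K * exp (- \<nu> * (t - \<sigma>))" if t: "\<sigma> \<le> t" "t \<le> T" for t
    proof (rule delay_equation_exp_bound[OF t(1) _ \<open>0 < b\<^sub>0\<close> \<open>0 \<le> F\<close> int _ _ x N(1) _ M \<open>M \<le> K\<close>])
      show "F + 2 * M \<le> K * (1 - \<nu> / b\<^sub>0)"
        unfolding \<rho>_def[symmetric] using \<open>0 < \<rho>\<close> \<open>0 \<le> M\<close> by (simp add: K_def field_simps)
      show "b\<^sub>0 \<le> b t' \<and> \<bar>d t' + b t' * x (h t')\<bar> \<le> b t' * F * exp (- \<nu> * (t' - \<sigma>))"
        if "t' \<in> {\<sigma>..t} - N" for t' using N(2)[of t'] that t by auto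
    qed (use b \<open>0 < \<nu>\<close> in auto)
    have "AE t in lebesgue. \<sigma> \<le> t \<and> t \<le> T \<longrightarrow> \<bar>d t * exp (\<nu> * (t - \<sigma>))\<bar> \<le> \<alpha> * (s * (U + M)) + \<beta> * (r * K)"
      unfolding weight using eq dg
    proof eventually_elim
      case (elim t)
      show ?case
      proof
        let ?e = "exp (- \<nu> * (t - \<sigma>))"
        assume t: "\<sigma> \<le> t \<and> t \<le> T"
        have "\<nu> * (t - h t) \<le> \<nu> * \<tau>" using elim t \<open>0 < \<nu>\<close> by (intro mult_left_mono) auto
        then have e: "exp (- \<nu> * (h t - \<sigma>)) \<le> r * ?e"
          by (simp add: exp_add[symmetric] r_def algebra_simps)
        have xh: "\<bar>x (h t)\<bar> \<le> K * (r * ?e)"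
        proof (cases "\<sigma> \<le> h t")
          case True
          then have "\<bar>x (h t)\<bar> \<le> K * exp (- \<nu> * (h t - \<sigma>))" using xK[of "h t"] b[of t] t by auto
          also have "\<dots> \<le> K * (r * ?e)" using e \<open>0 \<le> K\<close> by (rule mult_left_mono)
          finally show ?thesis .
        next
          case False
          have "1 \<le> exp (- \<nu> * (h t - \<sigma>))" using False \<open>0 < \<nu>\<close> by (simp add: mult_nonneg_nonpos)
          then have "1 \<le> r * ?e" using e by linarith
          then have "M * 1 \<le> K * (r * ?e)" using \<open>M \<le> K\<close> \<open>0 \<le> K\<close> by (intro mult_mono) auto
          then show ?thesis using M[of "h t"] False by simp
        qed
        have "d t = a t * d (g t) - b t * x (h t)" using elim t by (auto simp: algebra_simps)
        then have "\<bar>d t\<bar> = \<bar>a t * d (g t) - b t * x (h t)\<bar>" by simp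
        also have "\<dots> \<le> \<bar>a t\<bar> * \<bar>d (g t)\<bar> + b t * \<bar>x (h t)\<bar>"
          using b[of t] t by (metis abs_mult abs_of_nonneg abs_triangle_ineq4)
        also have "\<dots> \<le> \<alpha> * (s * (U + M) * ?e) + \<beta> * (K * (r * ?e))"
          using elim t xh b[of t] c by (intro add_mono mult_mono) auto
        finally show "\<bar>d t\<bar> \<le> (\<alpha> * (s * (U + M)) + \<beta> * (r * K)) * ?e" by (simp add: algebra_simps)
      qed
    qed
    \<comment> \<open>The equation yields another essential bound for the same weighted derivative,
      and \<open>U\<close> is the least one.\<close>
    then have "U \<le> \<alpha> * (s * (U + M)) + \<beta> * (r * K)"
      using c sr \<open>0 \<le> U\<close> \<open>0 \<le> M\<close> \<open>0 \<le> K\<close> by (intro least) auto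
    also have "\<dots> = q * U + c1 * M"
      using \<open>0 < \<rho>\<close> by (simp add: K_def F_def q_def c1_def field_simps)
    finally have "U * (1 - q) \<le> c1 * M" by (simp add: algebra_simps)
    then have "U \<le> c1 * M / (1 - q)" using \<open>q < 1\<close> by (simp add: pos_le_divide_eq)
    then have "U + M \<le> (c1 / (1 - q) + 1) * M" by (simp add: algebra_simps)
    then have "A * s * (U + M) \<le> A * s * ((c1 / (1 - q) + 1) * M)"
      using c sr by (intro mult_left_mono) auto
    then have "(A * s * (U + M) + 2 * M) / \<rho> \<le> (A * s * ((c1 / (1 - q) + 1) * M) + 2 * M) / \<rho>"
      using \<open>0 < \<rho>\<close> by (intro divide_right_mono) auto
    then have "K \<le> C * M"
      by (simp add: K_def C_def F_def algebra_simps add_divide_distrib)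
    then have "K * exp (- \<nu> * (T - \<sigma>)) \<le> C * M * exp (- \<nu> * (T - \<sigma>))" by (intro mult_right_mono) auto
    with xK[OF \<open>\<sigma> \<le> T\<close> order_refl] show "\<bar>x T\<bar> \<le> C * M * exp (- \<nu> * (T - \<sigma>))"
      by (rule order_trans)
  qed
qed

text \<open>With a growing weight, delayed arguments cost nothing, since the weight at
  \<open>g t\<close> or \<open>h t\<close> is at most the weight at \<open>t\<close>. Integrating
  the derivative gains a factor \<open>1 / \<mu>\<close>, so a large \<mu> makes the term with
  \<open>b\<close> small and only \<open>a\<^sub>0 < 1\<close> is left for the contraction. The
  derivative is bounded along with \<open>x\<close>, so that the trajectory can be restarted at
  \<open>T\<close>.\<close>

lemma neutral_delay_growth_bound:
  fixes a\<^sub>0 \<beta> L :: real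
  assumes c: "0 \<le> a\<^sub>0" "a\<^sub>0 < 1" "0 \<le> \<beta>" "0 \<le> L"
  shows "\<exists>C\<ge>1. \<forall>\<sigma> a b g h x d M T.
    neutral_trajectory \<sigma> a b g h x d M \<and> \<sigma> \<le> T \<and> T \<le> \<sigma> + L \<and>
    (AE t in lebesgue. \<sigma> \<le> t \<longrightarrow> \<bar>a t\<bar> \<le> a\<^sub>0 \<and> \<bar>b t\<bar> \<le> \<beta>) \<longrightarrow>
    (\<forall>t\<le>T. \<bar>x t\<bar> \<le> C * M) \<and> (AE s in lebesgue. s \<le> T \<longrightarrow> \<bar>d s\<bar> \<le> C * M)"
proof -
  \<comment> \<open>Chosen so that \<beta> / \<mu> is at most half of \<open>1 - a\<^sub>0\<close>;
    the other half yields \<open>c1\<close>. The summand 1 gives \<mu> \<ge> 1.\<close>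
  define \<mu> where "\<mu> = 2 * \<beta> / (1 - a\<^sub>0) + 1"
  have "1 \<le> \<mu>" using c by (simp add: \<mu>_def)
  define c1 where "c1 = 2 * (a\<^sub>0 + \<beta>) / (1 - a\<^sub>0)"
  have "0 \<le> c1" using c by (simp add: c1_def)
  define C where "C = (c1 + 1) * exp (\<mu> * L)"
  have eL: "1 \<le> exp (\<mu> * L)" using \<open>1 \<le> \<mu>\<close> \<open>0 \<le> L\<close> by simp
  have "1 * 1 \<le> C" unfolding C_def using eL \<open>0 \<le> c1\<close> by (intro mult_mono) auto
  have "1 \<le> C" using \<open>1 * 1 \<le> C\<close> by simp
  show ?thesis
  proof (rule exI[of _ C], rule conjI[OF \<open>1 \<le> C\<close>], rule allI, rule allI, rule allI, rule allI,
      rule allI, rule allI, rule allI, rule allI, rule allI, rule impI)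
    fix a b g h x d :: "real \<Rightarrow> real" and \<sigma> M T :: real
    assume hyps: "neutral_trajectory \<sigma> a b g h x d M \<and> \<sigma> \<le> T \<and> T \<le> \<sigma> + L \<and>
      (AE t in lebesgue. \<sigma> \<le> t \<longrightarrow> \<bar>a t\<bar> \<le> a\<^sub>0 \<and> \<bar>b t\<bar> \<le> \<beta>)"
    then have T: "\<sigma> \<le> T" "T \<le> \<sigma> + L"
      and x: "\<And>s t. \<sigma> \<le> s \<Longrightarrow> s \<le> t \<Longrightarrow> (d has_integral (x t - x s)) {s..t}"
      and bdd: "\<exists>K. AE t in lebesgue. \<sigma> \<le> t \<and> t \<le> T \<longrightarrow> \<bar>d t\<bar> \<le> K"
      and pull: "\<And>P. (AE s in lebesgue. P s) \<Longrightarrow> (AE t in lebesgue. \<sigma> \<le> t \<longrightarrow> P (g t))"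
      and M: "\<And>s. s \<le> \<sigma> \<Longrightarrow> \<bar>x s\<bar> \<le> M"
      and dM: "AE s in lebesgue. s < \<sigma> \<longrightarrow> \<bar>d s\<bar> \<le> M"
      unfolding neutral_trajectory_def by simp_all
    have "AE t in lebesgue. \<sigma> \<le> t \<longrightarrow> d t - a t * d (g t) + b t * x (h t) = 0 \<and> g t \<le> t \<and> h t \<le> t"
      "AE t in lebesgue. \<sigma> \<le> t \<longrightarrow> \<bar>a t\<bar> \<le> a\<^sub>0 \<and> \<bar>b t\<bar> \<le> \<beta>"
      using hyps unfolding neutral_trajectory_def by blast+
    then have eq: "AE t in lebesgue. \<sigma> \<le> t \<longrightarrow> d t - a t * d (g t) + b t * x (h t) = 0 \<and>
        \<bar>a t\<bar> \<le> a\<^sub>0 \<and> \<bar>b t\<bar> \<le> \<beta> \<and> g t \<le> t \<and> h t \<le> t"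
      by eventually_elim blast
    have "0 \<le> M" using M[of \<sigma>] by simp
    obtain K\<^sub>0 where K\<^sub>0: "AE t in lebesgue. \<sigma> \<le> t \<and> t \<le> T \<longrightarrow> \<bar>d t\<bar> \<le> K\<^sub>0" using bdd by blast
    have "AE t in lebesgue. \<sigma> \<le> t \<and> t \<le> T \<longrightarrow> \<bar>d t * exp (- \<mu> * (t - \<sigma>))\<bar> \<le> \<bar>K\<^sub>0\<bar> * 1"
      using K\<^sub>0
    proof eventually_elim
      case (elim t)
      then show ?case using \<open>1 \<le> \<mu>\<close> unfolding abs_mult by (intro impI mult_mono) auto
    qed
    then obtain U where "0 \<le> U"
      and U: "AE t in lebesgue. \<sigma> \<le> t \<and> t \<le> T \<longrightarrow> \<bar>d t * exp (- \<mu> * (t - \<sigma>))\<bar> \<le> U"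
      and least: "\<And>K. 0 \<le> K \<Longrightarrow> AE t in lebesgue. \<sigma> \<le> t \<and> t \<le> T \<longrightarrow> \<bar>d t * exp (- \<mu> * (t - \<sigma>))\<bar> \<le> K \<Longrightarrow> U \<le> K"
      by (rule least_ess_bound) blast
    have weight: "\<bar>d t * exp (- \<mu> * (t - \<sigma>))\<bar> \<le> K \<longleftrightarrow> \<bar>d t\<bar> \<le> K * exp (\<mu> * (t - \<sigma>))" for t K
      using abs_mult_exp_le_iff[of "d t" "- \<mu> * (t - \<sigma>)" K] by simp
    note U = U[unfolded weight]
    then obtain N where N: "negligible N"
      "\<And>t. t \<notin> N \<Longrightarrow> \<sigma> \<le> t \<and> t \<le> T \<longrightarrow> \<bar>d t\<bar> \<le> U * exp (\<mu> * (t - \<sigma>))"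
      by (rule AE_lebesgue_negligible) blast
    have xU: "\<bar>x t\<bar> \<le> (M + U / \<mu>) * exp (\<mu> * (t - \<sigma>))" if t: "\<sigma> \<le> t" "t \<le> T" for t
    proof -
      have "0 \<le> U / \<mu> * (exp (\<mu> * (t - \<sigma>)) - exp (\<mu> * (\<sigma> - \<sigma>))) - c * (x t - x \<sigma>)" if "\<bar>c\<bar> = 1" for c :: real
      proof (rule has_integral_nonneg_negligible[OF _ N(1)])
        show "((\<lambda>r. U / \<mu> * (\<mu> * exp (\<mu> * (r - \<sigma>))) - c * d r) has_integral
          (U / \<mu> * (exp (\<mu> * (t - \<sigma>)) - exp (\<mu> * (\<sigma> - \<sigma>))) - c * (x t - x \<sigma>))) {\<sigma>..t}"
          using t by (intro has_integral_diff has_integral_mult_right has_integral_exp_linear x) auto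
        fix r assume "r \<in> {\<sigma>..t} - N"
        then have "\<bar>c * d r\<bar> \<le> U * exp (\<mu> * (r - \<sigma>))" using N(2)[of r] t that by (auto simp: abs_mult)
        then show "0 \<le> U / \<mu> * (\<mu> * exp (\<mu> * (r - \<sigma>))) - c * d r"
          using \<open>1 \<le> \<mu>\<close> by (simp add: abs_le_iff)
      qed
      from this[of 1] this[of "- 1"] have "\<bar>x t - x \<sigma>\<bar> \<le> U / \<mu> * (exp (\<mu> * (t - \<sigma>)) - 1)"
        by (simp add: abs_le_iff)
      moreover have "U / \<mu> * (exp (\<mu> * (t - \<sigma>)) - 1) \<le> U / \<mu> * exp (\<mu> * (t - \<sigma>))"
        using \<open>0 \<le> U\<close> \<open>1 \<le> \<mu>\<close> by (intro mult_left_mono) auto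
      moreover have "M * 1 \<le> M * exp (\<mu> * (t - \<sigma>))"
        using \<open>0 \<le> M\<close> \<open>1 \<le> \<mu>\<close> t by (intro mult_left_mono) auto
      ultimately show ?thesis using M[of \<sigma>] by (simp add: algebra_simps)
    qed
    have "AE s in lebesgue. (\<sigma> \<le> s \<and> s \<le> T \<longrightarrow> \<bar>d s\<bar> \<le> U * exp (\<mu> * (s - \<sigma>))) \<and> (s < \<sigma> \<longrightarrow> \<bar>d s\<bar> \<le> M)"
      using U dM by eventually_elim auto
    from pull[OF this] eq
    have "AE t in lebesgue. \<sigma> \<le> t \<and> t \<le> T \<longrightarrow>
      \<bar>d t * exp (- \<mu> * (t - \<sigma>))\<bar> \<le> a\<^sub>0 * (U + M) + \<beta> * (M + U / \<mu>)"
      unfolding weight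
    proof eventually_elim
      case (elim t)
      show ?case
      proof
        let ?e = "exp (\<mu> * (t - \<sigma>))"
        assume t: "\<sigma> \<le> t \<and> t \<le> T"
        have e: "exp (\<mu> * (s - \<sigma>)) \<le> ?e" if "s \<le> t" for s
          using that \<open>1 \<le> \<mu>\<close> by simp
        have "1 \<le> ?e" using t \<open>1 \<le> \<mu>\<close> by simp
        have dg: "\<bar>d (g t)\<bar> \<le> (U + M) * ?e"
        proof (cases "\<sigma> \<le> g t")
          case True
          then have "\<bar>d (g t)\<bar> \<le> U * exp (\<mu> * (g t - \<sigma>))" using elim t by auto
          also have "\<dots> \<le> (U + M) * ?e" using e[of "g t"] elim t \<open>0 \<le> U\<close> \<open>0 \<le> M\<close> by (intro mult_mono) auto
          finally show ?thesis .
        next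
          case False
          then have "\<bar>d (g t)\<bar> \<le> M * 1" using elim t by auto
          also have "\<dots> \<le> (U + M) * ?e" using \<open>1 \<le> ?e\<close> \<open>0 \<le> U\<close> \<open>0 \<le> M\<close> by (intro mult_mono) auto
          finally show ?thesis .
        qed
        have xh: "\<bar>x (h t)\<bar> \<le> (M + U / \<mu>) * ?e"
        proof (cases "\<sigma> \<le> h t")
          case True
          then have "\<bar>x (h t)\<bar> \<le> (M + U / \<mu>) * exp (\<mu> * (h t - \<sigma>))" using xU[of "h t"] elim t by auto
          also have "\<dots> \<le> (M + U / \<mu>) * ?e"
            using e[of "h t"] elim t \<open>0 \<le> U\<close> \<open>0 \<le> M\<close> \<open>1 \<le> \<mu>\<close> by (intro mult_left_mono) auto
          finally show ?thesis .
        next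
          case False
          then have "\<bar>x (h t)\<bar> \<le> M * 1" using M[of "h t"] by auto
          also have "\<dots> \<le> (M + U / \<mu>) * ?e"
            using \<open>1 \<le> ?e\<close> \<open>0 \<le> U\<close> \<open>0 \<le> M\<close> \<open>1 \<le> \<mu>\<close> by (intro mult_mono) auto
          finally show ?thesis .
        qed
        have "d t = a t * d (g t) - b t * x (h t)" using elim t by (auto simp: algebra_simps)
        then have "\<bar>d t\<bar> = \<bar>a t * d (g t) - b t * x (h t)\<bar>" by simp
        also have "\<dots> \<le> \<bar>a t\<bar> * \<bar>d (g t)\<bar> + \<bar>b t\<bar> * \<bar>x (h t)\<bar>"
          by (metis abs_mult abs_triangle_ineq4)
        also have "\<dots> \<le> a\<^sub>0 * ((U + M) * ?e) + \<beta> * ((M + U / \<mu>) * ?e)"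
          using elim t xh dg c by (intro add_mono mult_mono) auto
        finally show "\<bar>d t\<bar> \<le> (a\<^sub>0 * (U + M) + \<beta> * (M + U / \<mu>)) * ?e" by (simp add: algebra_simps)
      qed
    qed
    then have "U \<le> a\<^sub>0 * (U + M) + \<beta> * (M + U / \<mu>)"
      using c \<open>0 \<le> U\<close> \<open>0 \<le> M\<close> \<open>1 \<le> \<mu>\<close> by (intro least) auto
    moreover have "\<beta> / \<mu> \<le> (1 - a\<^sub>0) / 2"
    proof -
      have "(1 - a\<^sub>0) * \<mu> = 2 * \<beta> + (1 - a\<^sub>0)" using c by (simp add: \<mu>_def field_simps)
      then show ?thesis using \<open>1 \<le> \<mu>\<close> c by (simp add: divide_le_eq)
    qed
    then have "\<beta> / \<mu> * U \<le> (1 - a\<^sub>0) / 2 * U" using \<open>0 \<le> U\<close> by (rule mult_right_mono)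
    moreover define \<kappa> where "\<kappa> = \<beta> / \<mu>"
    have "\<beta> * (M + U / \<mu>) = \<beta> * M + \<kappa> * U" by (simp add: \<kappa>_def algebra_simps)
    ultimately have "U \<le> a\<^sub>0 * (U + M) + (\<beta> * M + \<kappa> * U)" "\<kappa> * U \<le> (1 - a\<^sub>0) / 2 * U"
      by (simp_all only: \<kappa>_def)
    then have "U * (1 - a\<^sub>0) \<le> 2 * (a\<^sub>0 + \<beta>) * M" by (simp add: field_simps)
    then have "U \<le> c1 * M" using c by (simp add: c1_def field_simps)
    moreover have "U / \<mu> \<le> U" using \<open>0 \<le> U\<close> \<open>1 \<le> \<mu>\<close> by (simp add: divide_le_eq mult_le_cancel_left1)
    ultimately have UM: "U \<le> (c1 + 1) * M" "M + U / \<mu> \<le> (c1 + 1) * M" "M \<le> (c1 + 1) * M"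
      using \<open>0 \<le> M\<close> \<open>0 \<le> c1\<close> by (simp_all add: algebra_simps)
    have e: "exp (\<mu> * (t - \<sigma>)) \<le> exp (\<mu> * L)" if "t \<le> T" for t
      using that T \<open>1 \<le> \<mu>\<close> by simp
    have fin: "z \<le> C * M" if "z \<le> y * e" "0 \<le> y" "y \<le> (c1 + 1) * M" "e \<le> exp (\<mu> * L)" for z y e
    proof -
      have "y * e \<le> y * exp (\<mu> * L)" using that by (intro mult_left_mono)
      also have "\<dots> \<le> (c1 + 1) * M * exp (\<mu> * L)" using that by (intro mult_right_mono) auto
      finally show ?thesis using that by (simp add: C_def mult_ac)
    qed
    have MC: "z \<le> C * M" if "z \<le> M" for z
      using fin[of z M 1] that \<open>0 \<le> M\<close> UM(3) eL by simp
    show "(\<forall>t\<le>T. \<bar>x t\<bar> \<le> C * M) \<and> (AE s in lebesgue. s \<le> T \<longrightarrow> \<bar>d s\<bar> \<le> C * M)"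
    proof (intro conjI allI impI)
      fix t assume "t \<le> T"
      show "\<bar>x t\<bar> \<le> C * M"
        using xU[of t] M[of t] MC fin[OF _ _ UM(2) e[OF \<open>t \<le> T\<close>]] \<open>0 \<le> M\<close> \<open>0 \<le> U\<close> \<open>1 \<le> \<mu>\<close> \<open>t \<le> T\<close>
        by (cases "t \<le> \<sigma>") auto
    next
      show "AE s in lebesgue. s \<le> T \<longrightarrow> \<bar>d s\<bar> \<le> C * M"
        using U dM
      proof eventually_elim
        case (elim s)
        then show ?case
          using MC fin[OF _ \<open>0 \<le> U\<close> UM(1) e[of s]] by (cases "s < \<sigma>") auto
      qed
    qed
  qed
qed

section \<open>Essential norms and solutions\<close>

lemma AE_ess_norm:
  assumes "ess_norm s f \<le> ereal K"
  shows "AE t in lebesgue. s \<le> t \<longrightarrow> \<bar>f t\<bar> \<le> K"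
proof -
  have "AE t in lebesgue_on {s..}. ereal \<bar>f t\<bar> \<le> ess_norm s f"
    unfolding ess_norm_def by (rule esssup_AE)
  then have "AE t in lebesgue. t \<in> {s..} \<longrightarrow> ereal \<bar>f t\<bar> \<le> ess_norm s f"
    by (simp add: AE_restrict_space_iff)
  then show ?thesis
    by eventually_elim (use assms in \<open>auto dest: order_trans\<close>)
qed

lemma AE_lebesgue_atLeast_ex:
  fixes s :: real
  assumes "AE t in lebesgue. s \<le> t \<longrightarrow> P t"
  shows "\<exists>t\<ge>s. P t"
proof (rule ccontr)
  assume *: "\<not> (\<exists>t\<ge>s. P t)"
  obtain N where N: "negligible N" "\<And>t. t \<notin> N \<Longrightarrow> s \<le> t \<longrightarrow> P t"
    using AE_lebesgue_negligible[OF assms] by blast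
  have "cbox s (s + 1) \<subseteq> N"
  proof
    fix t assume "t \<in> cbox s (s + 1)"
    then show "t \<in> N" using * N(2)[of t] by auto
  qed
  then have "negligible (cbox s (s + 1))" using N(1) negligible_subset by blast
  then show False unfolding negligible_interval by simp
qed

lemma ess_norm_ge:
  assumes "\<And>t. s \<le> t \<Longrightarrow> c \<le> \<bar>f t\<bar>"
  shows "ereal c \<le> ess_norm s f"
proof (cases "ess_norm s f = \<infinity>")
  case False
  show ?thesis
  proof (rule ereal_le_real)
    fix K assume "ess_norm s f \<le> ereal K"
    then obtain t where "s \<le> t" "\<bar>f t\<bar> \<le> K"
      using AE_lebesgue_atLeast_ex[OF AE_ess_norm] by blast
    then show "ereal c \<le> ereal K" using assms[of t] by simp
  qed
qed simp

text \<open>Here absolute continuity of a solution is used up: afterwards \<open>x\<close> is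
  accessible through integrals of its derivative.\<close>

lemma solution_has_integral_deriv:
  assumes sol: "solution a b g h \<sigma> \<phi> \<psi> x" and "\<sigma> \<le> s" "s \<le> t"
  shows "(neutral_deriv \<sigma> \<psi> x has_integral (x t - x s)) {s..t}"
proof -
  have "AE t in lebesgue_on {\<sigma>..}. x differentiable (at t)"
    using sol unfolding solution_def by (auto elim: eventually_mono)
  then have "AE t in lebesgue. t \<in> {\<sigma>..} \<longrightarrow> x differentiable (at t)"
    by (simp add: AE_restrict_space_iff)
  then obtain N where N: "negligible N" "\<And>t. t \<notin> N \<Longrightarrow> t \<in> {\<sigma>..} \<longrightarrow> x differentiable (at t)"
    by (rule AE_lebesgue_negligible) blast
  have "absolutely_continuous_fun \<sigma> t x" using sol by (simp add: solution_def)
  then have ac: "absolutely_continuous_fun s t x"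
    unfolding absolutely_continuous_fun_def
    by (meson \<open>\<sigma> \<le> s\<close> atLeastatMost_subset_iff order_refl order_trans)
  have "(deriv x has_integral (x t - x s)) {s..t}"
  proof (rule absolutely_continuous_fun_has_integral_deriv[OF \<open>s \<le> t\<close> ac N(1)])
    fix r assume "r \<in> {s..t} - N"
    then have "x differentiable (at r)" using N(2)[of r] \<open>\<sigma> \<le> s\<close> by auto
    then show "(x has_real_derivative deriv x r) (at r within {s..t})"
      by (simp add: DERIV_deriv_iff_real_differentiable has_field_derivative_at_within)
  qed
  then show ?thesis
    by (rule has_integral_eq[rotated]) (use \<open>\<sigma> \<le> s\<close> in \<open>auto simp: neutral_deriv_def\<close>)
qed

text \<open>A real \<open>SUP\<close> bounds its family only when the family is bounded above;
  boundedness of the initial data supplies this.\<close>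

lemma initial_data_le_SUP:
  assumes "initial_data \<sigma> \<phi> \<psi>"
  defines "N \<equiv> (SUP r\<in>{..\<sigma>}. \<bar>\<phi> r\<bar> + (if r < \<sigma> then \<bar>\<psi> r\<bar> else 0))"
  shows "r \<le> \<sigma> \<Longrightarrow> \<bar>\<phi> r\<bar> \<le> N" "r < \<sigma> \<Longrightarrow> \<bar>\<psi> r\<bar> \<le> N"
proof -
  obtain A B where A: "\<And>r. r \<le> \<sigma> \<Longrightarrow> \<bar>\<phi> r\<bar> \<le> A" and B: "\<And>r. r < \<sigma> \<Longrightarrow> \<bar>\<psi> r\<bar> \<le> B"
    using assms(1) unfolding initial_data_def bounded_iff by fastforce
  have "bdd_above ((\<lambda>r. \<bar>\<phi> r\<bar> + (if r < \<sigma> then \<bar>\<psi> r\<bar> else 0)) ` {..\<sigma>})"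
  proof (rule bdd_aboveI2)
    fix r assume "r \<in> {..\<sigma>}"
    then show "\<bar>\<phi> r\<bar> + (if r < \<sigma> then \<bar>\<psi> r\<bar> else 0) \<le> A + max 0 B"
      using A[of r] B[of r] by auto
  qed
  then have le: "\<bar>\<phi> r\<bar> + (if r < \<sigma> then \<bar>\<psi> r\<bar> else 0) \<le> N" if "r \<le> \<sigma>" for r
    unfolding N_def using that by (intro cSUP_upper) auto
  show "r \<le> \<sigma> \<Longrightarrow> \<bar>\<phi> r\<bar> \<le> N" using le[of r] by (auto split: if_splits)
  show "r < \<sigma> \<Longrightarrow> \<bar>\<psi> r\<bar> \<le> N" using le[of r] by auto
qed

text \<open>Truncation at the levels -K and K changes \<open>f\<close> only on a null set and makes
  it bounded everywhere.\<close>

lemma absolutely_integrable_on_ess_bounded: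
  fixes f :: "real \<Rightarrow> real"
  assumes f: "f \<in> borel_measurable lebesgue" and K: "AE t in lebesgue. \<bar>f t\<bar> \<le> K"
  shows "f absolutely_integrable_on {l..r}"
proof -
  obtain N where N: "negligible N" "\<And>t. t \<notin> N \<Longrightarrow> \<bar>f t\<bar> \<le> K"
    using AE_lebesgue_negligible[OF K] by blast
  have "(\<lambda>t. max (- K) (min K (f t))) absolutely_integrable_on {l..r}"
  proof (rule measurable_bounded_by_integrable_imp_absolutely_integrable)
    show "(\<lambda>t. max (- K) (min K (f t))) \<in> borel_measurable (lebesgue_on {l..r})"
      by (intro measurable_restrict_space1 borel_measurable_max borel_measurable_min borel_measurable_const f)
    show "(\<lambda>_. \<bar>K\<bar>) integrable_on {l..r}" by (rule integrable_const_ivl)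
  qed auto
  then show ?thesis
    by (rule absolutely_integrable_spike[OF _ N(1)]) (use N(2) in force)
qed

text \<open>Initial points before \<open>t\<^sub>0\<close> form a separate claim, since on [0,
  \<open>t\<^sub>0\<close>) the function \<open>a\<close> is only essentially bounded. Where
  \<open>a = 1\<close> and \<open>g t = t\<close>, for instance, the derivative drops out of the
  equation. The premise \<open>ess_norm 0 a \<le> ereal a\<^sub>0\<close> restores the contraction
  needed for the growth estimate there.\<close>

theorem theorem4p2:
  fixes a b g h :: "real \<Rightarrow> real" and t\<^sub>0 a\<^sub>0 b\<^sub>0 \<delta> \<tau> :: real
  assumes "t\<^sub>0 \<ge> 0"
    and "a \<in> borel_measurable (lebesgue_on {0..})" "b \<in> borel_measurable (lebesgue_on {0..})"
    and "g \<in> borel_measurable (lebesgue_on {0..})" "h \<in> borel_measurable (lebesgue_on {0..})"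
    and "ess_norm 0 a < \<infinity>" "ess_norm 0 b < \<infinity>"
    and "ess_norm t\<^sub>0 a \<le> ereal a\<^sub>0" "a\<^sub>0 < 1"
    and "\<And>t. t \<ge> 0 \<Longrightarrow> b t \<ge> 0"
    and "\<And>t. t \<ge> 0 \<Longrightarrow> g t \<le> t" "\<And>t. t \<ge> 0 \<Longrightarrow> h t \<le> t"
    and "filterlim g at_top at_top" "filterlim h at_top at_top"
    and "\<And>E. E \<in> null_sets lebesgue \<Longrightarrow> {t. t \<ge> 0 \<and> g t \<in> E} \<in> null_sets lebesgue"
    and "\<delta> > 0" "\<And>t. t \<ge> t\<^sub>0 \<Longrightarrow> t - g t \<le> \<delta>"
    and "\<tau> > 0" "\<And>t. t \<ge> t\<^sub>0 \<Longrightarrow> t - h t \<le> \<tau>"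
    and "0 < b\<^sub>0" "\<And>t. t \<ge> t\<^sub>0 \<Longrightarrow> b\<^sub>0 \<le> b t"
    and "\<And>t. t \<ge> t\<^sub>0 \<Longrightarrow>
           (LINT s:{h t..t}|lebesgue. (if s < 0 then 0 else b s)) \<le> 1 / exp 1"
    and "ess_norm t\<^sub>0 a + ess_norm t\<^sub>0 b * ess_norm t\<^sub>0 (\<lambda>t. a t / b t) < 1"
  shows "exponentially_stable_from t\<^sub>0 a b g h \<and>
         (ess_norm 0 a \<le> ereal a\<^sub>0 \<longrightarrow> exponentially_stable_from 0 a b g h)"
proof -
  \<comment> \<open>The extension of \<open>b\<close> by 0 to negative times, as in the integral
    condition; it is measurable on the whole line.\<close>
  define B where "B t = (if t < 0 then 0 else b t)" for t
  have nonneg: "0 \<le> ess_norm s f" for s f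
    using ess_norm_ge[of s 0 f] by (simp add: zero_ereal_def)
  obtain \<alpha> where \<alpha>: "ess_norm t\<^sub>0 a = ereal \<alpha>" "0 \<le> \<alpha>"
    using nonneg[of t\<^sub>0 a] assms(8) by (cases "ess_norm t\<^sub>0 a") auto
  obtain \<beta>\<^sub>0 where \<beta>\<^sub>0: "ess_norm 0 b = ereal \<beta>\<^sub>0" "0 \<le> \<beta>\<^sub>0"
    using nonneg[of 0 b] assms(7) by (cases "ess_norm 0 b") auto
  have bAE: "AE t in lebesgue. 0 \<le> t \<longrightarrow> \<bar>b t\<bar> \<le> \<beta>\<^sub>0"
    by (rule AE_ess_norm) (simp add: \<beta>\<^sub>0)
  have "b \<in> borel_measurable (lebesgue_on {t\<^sub>0..})"
    using assms(1) by (intro measurable_restrict_mono[OF assms(3)]) auto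
  then have "ess_norm t\<^sub>0 b \<le> ereal \<beta>\<^sub>0"
    unfolding ess_norm_def
  proof (intro esssup_I)
    have "AE t in lebesgue. t \<in> {t\<^sub>0..} \<longrightarrow> ereal \<bar>b t\<bar> \<le> ereal \<beta>\<^sub>0"
      using bAE by eventually_elim (use assms(1) in auto)
    then show "AE t in lebesgue_on {t\<^sub>0..}. ereal \<bar>b t\<bar> \<le> ereal \<beta>\<^sub>0"
      by (simp add: AE_restrict_space_iff)
  qed measurable
  moreover have "ereal b\<^sub>0 \<le> ess_norm t\<^sub>0 b"
    using assms(21) by (intro ess_norm_ge) force
  ultimately obtain \<beta> where \<beta>: "ess_norm t\<^sub>0 b = ereal \<beta>" "b\<^sub>0 \<le> \<beta>"
    by (cases "ess_norm t\<^sub>0 b") auto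
  \<comment> \<open>As \<beta> \<ge> \<open>b\<^sub>0\<close> > 0, an infinite norm of a / b would
    make the product infinite, against the smallness assumption.\<close>
  obtain A where A: "ess_norm t\<^sub>0 (\<lambda>t. a t / b t) = ereal A" "0 \<le> A"
    using nonneg[of t\<^sub>0 "\<lambda>t. a t / b t"] assms(23) \<alpha> \<beta> assms(20)
    by (cases "ess_norm t\<^sub>0 (\<lambda>t. a t / b t)") auto
  have less: "\<alpha> + \<beta> * A < 1"
    using assms(23) by (simp add: \<alpha> \<beta> A)
  have "0 \<le> \<beta>" using \<beta> assms(20) by simp

  have "(\<lambda>t. if t \<in> {0..} then b t else 0) \<in> borel_measurable lebesgue"
    using assms(3) by (subst borel_measurable_if) auto
  also have "(\<lambda>t. if t \<in> {0..} then b t else 0) = B" by (auto simp: B_def)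
  finally have B_meas: "B \<in> borel_measurable lebesgue" .
  have B_abs: "B absolutely_integrable_on {l..r}" for l r
    by (rule absolutely_integrable_on_ess_bounded[OF B_meas, of \<beta>\<^sub>0])
      (use bAE \<beta>\<^sub>0 in \<open>auto simp: B_def elim: eventually_mono\<close>)
  have B_int: "B integrable_on {l..r}" for l r
    using B_abs set_lebesgue_integral_eq_integral(1) by blast
  have B0: "0 \<le> B t" for t using assms(10) by (simp add: B_def)
  \<comment> \<open>The barrier argument needs the upper bound \<beta> at every point, while the
    essential norm gives it almost everywhere. Truncation equals \<open>b\<close> almost everywhere
    after \<open>t\<^sub>0\<close> and does not increase the integrals over delay intervals.\<close>
  define B' where "B' t = min \<beta> (B t)" for t
  have B': "0 \<le> B' t \<and> B' t \<le> \<beta>" for t using B0 \<open>0 \<le> \<beta>\<close> by (simp add: B'_def)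
  have B'_int: "B' integrable_on {l..r}" for l r
  proof -
    have "B' absolutely_integrable_on {l..r}"
      unfolding B'_def by (rule absolutely_integrable_on_ess_bounded[where K = \<beta>])
        (use B_meas B0 \<open>0 \<le> \<beta>\<close> in auto)
    then show ?thesis using set_lebesgue_integral_eq_integral(1) by blast
  qed
  have B'_integral: "integral {max \<sigma> (h t)..t} B' \<le> 1 / exp 1" if "t\<^sub>0 \<le> t" for \<sigma> t
  proof -
    have "integral {max \<sigma> (h t)..t} B' \<le> integral {max \<sigma> (h t)..t} B"
      by (intro integral_le B_int B'_int) (simp add: B'_def)
    also have "\<dots> \<le> integral {h t..t} B"
      by (intro integral_subset_le B_int) (auto simp: B0)
    also have "\<dots> = (LINT s:{h t..t}|lebesgue. (if s < 0 then 0 else b s))"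
      using set_lebesgue_integral_eq_integral(2)[OF B_abs] by (simp add: B_def)
    also have "\<dots> \<le> 1 / exp 1" by (rule assms(22)[OF that])
    finally show ?thesis .
  qed
  have pull: "AE t in lebesgue. s \<le> t \<longrightarrow> P (g t)" if P: "AE t in lebesgue. P t" and s: "0 \<le> s" for P s
  proof -
    obtain N where N: "negligible N" "\<And>t. t \<notin> N \<Longrightarrow> P t"
      using AE_lebesgue_negligible[OF P] by blast
    then have "{t. t \<ge> 0 \<and> g t \<in> N} \<in> null_sets lebesgue"
      using assms(15) negligible_iff_null_sets by blast
    then show ?thesis by (rule AE_I') (use N(2) s in auto)
  qed
  have coeff: "AE t in lebesgue. t\<^sub>0 \<le> t \<longrightarrow> b t = B' t \<and> b\<^sub>0 \<le> B' t \<and> \<bar>a t\<bar> \<le> \<alpha> \<and> \<bar>a t\<bar> \<le> A * B' t"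
    using AE_ess_norm[OF eq_refl[OF \<alpha>(1)]] AE_ess_norm[OF eq_refl[OF \<beta>(1)]] AE_ess_norm[OF eq_refl[OF A(1)]]
  proof eventually_elim
    case (elim t)
    show ?case
    proof
      assume t: "t\<^sub>0 \<le> t"
      then have b: "b\<^sub>0 \<le> b t" "b t \<le> \<beta>" "0 \<le> t" using assms(21)[OF t] elim assms(1) by auto
      then have "b t = B' t" by (simp add: B'_def B_def)
      moreover have "\<bar>a t\<bar> \<le> A * b t"
        using elim t b assms(20) by (simp add: abs_divide divide_le_eq)
      ultimately show "b t = B' t \<and> b\<^sub>0 \<le> B' t \<and> \<bar>a t\<bar> \<le> \<alpha> \<and> \<bar>a t\<bar> \<le> A * B' t"
        using elim t b by auto
    qed
  qed

  obtain C \<nu> where "0 < C" "0 < \<nu>" and bound: "\<forall>\<sigma> a b g h x d M.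
    neutral_trajectory \<sigma> a b g h x d M \<and> (\<forall>T. b integrable_on {\<sigma>..T}) \<and>
    (\<forall>t\<ge>\<sigma>. 0 \<le> b t \<and> b t \<le> \<beta> \<and> h t \<le> t \<and> integral {max \<sigma> (h t)..t} b \<le> 1 / exp 1) \<and>
    (AE t in lebesgue. \<sigma> \<le> t \<longrightarrow>
      b\<^sub>0 \<le> b t \<and> \<bar>a t\<bar> \<le> \<alpha> \<and> \<bar>a t\<bar> \<le> A * b t \<and> t - \<delta> \<le> g t \<and> t - \<tau> \<le> h t) \<longrightarrow>
    (\<forall>t\<ge>\<sigma>. \<bar>x t\<bar> \<le> C * M * exp (- \<nu> * (t - \<sigma>)))"
    using neutral_delay_exp_bound[OF \<alpha>(2) \<open>0 \<le> \<beta>\<close> A(2) assms(20) less, of \<delta> \<tau>] by (elim exE conjE)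
  \<comment> \<open>The restart point \<open>s\<close> may exceed \<sigma>; the prescribed
    derivative before \<sigma> and the true one between \<sigma> and \<open>s\<close> together form
    the history.\<close>
  have trajectory: "neutral_trajectory s a b g h x (neutral_deriv \<sigma> \<psi> x) M"
    if sol: "solution a b g h \<sigma> \<phi> \<psi> x" and s: "\<sigma> \<le> s" "0 \<le> s"
      and x: "\<And>r. r \<le> s \<Longrightarrow> \<bar>x r\<bar> \<le> M" and d: "AE r in lebesgue. r < s \<longrightarrow> \<bar>neutral_deriv \<sigma> \<psi> x r\<bar> \<le> M"
    for \<sigma> \<phi> \<psi> x s M
    unfolding neutral_trajectory_def
  proof (intro conjI allI impI)
    have "AE t in lebesgue_on {\<sigma>..}. deriv x t - a t * neutral_deriv \<sigma> \<psi> x (g t) + b t * x (h t) = 0"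
      using sol unfolding solution_def by (auto elim: eventually_mono)
    then have "AE t in lebesgue. t \<in> {\<sigma>..} \<longrightarrow>
        deriv x t - a t * neutral_deriv \<sigma> \<psi> x (g t) + b t * x (h t) = 0"
      by (simp add: AE_restrict_space_iff)
    then show "AE t in lebesgue. s \<le> t \<longrightarrow>
      neutral_deriv \<sigma> \<psi> x t - a t * neutral_deriv \<sigma> \<psi> x (g t) + b t * x (h t) = 0 \<and> g t \<le> t \<and> h t \<le> t"
      by eventually_elim (use s assms(11,12) in \<open>auto simp: neutral_deriv_def\<close>)
  next
    fix T
    obtain K where "AE t in lebesgue_on {\<sigma>..T}. \<bar>deriv x t\<bar> \<le> K"
      using sol unfolding solution_def by blast
    then have "AE t in lebesgue. t \<in> {\<sigma>..T} \<longrightarrow> \<bar>deriv x t\<bar> \<le> K"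
      by (simp add: AE_restrict_space_iff)
    then have "AE t in lebesgue. s \<le> t \<and> t \<le> T \<longrightarrow> \<bar>neutral_deriv \<sigma> \<psi> x t\<bar> \<le> K"
      by eventually_elim (use s in \<open>auto simp: neutral_deriv_def\<close>)
    then show "\<exists>K. AE t in lebesgue. s \<le> t \<and> t \<le> T \<longrightarrow> \<bar>neutral_deriv \<sigma> \<psi> x t\<bar> \<le> K" ..
  next
    fix P :: "real \<Rightarrow> bool" assume "AE t in lebesgue. P t"
    then show "AE t in lebesgue. s \<le> t \<longrightarrow> P (g t)" using s by (intro pull)
  qed (use s x d solution_has_integral_deriv[OF sol] in auto)
  have trajectory_cong: "neutral_trajectory s a B' g h x d M"
    if "neutral_trajectory s a b g h x d M" "t\<^sub>0 \<le> s" for s x d M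
  proof -
    have "AE t in lebesgue. s \<le> t \<longrightarrow> d t - a t * d (g t) + b t * x (h t) = 0 \<and> g t \<le> t \<and> h t \<le> t"
      using that(1) unfolding neutral_trajectory_def by simp
    then have "AE t in lebesgue. s \<le> t \<longrightarrow> d t - a t * d (g t) + B' t * x (h t) = 0 \<and> g t \<le> t \<and> h t \<le> t"
      using coeff by eventually_elim (use that(2) in auto)
    with that(1) show ?thesis unfolding neutral_trajectory_def by simp
  qed
  have decay: "\<bar>x t\<bar> \<le> C * M * exp (- \<nu> * (t - s))"
    if x: "neutral_trajectory s a b g h x d M" and s: "t\<^sub>0 \<le> s" "s \<le> t" for s t x d M
  proof -
    have 1: "AE t in lebesgue. s \<le> t \<longrightarrow>
        b\<^sub>0 \<le> B' t \<and> \<bar>a t\<bar> \<le> \<alpha> \<and> \<bar>a t\<bar> \<le> A * B' t \<and> t - \<delta> \<le> g t \<and> t - \<tau> \<le> h t"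
      using coeff
    proof eventually_elim
      case (elim t)
      then show ?case using s assms(17)[of t] assms(19)[of t] by auto
    qed
    have 2: "\<forall>t\<ge>s. 0 \<le> B' t \<and> B' t \<le> \<beta> \<and> h t \<le> t \<and> integral {max s (h t)..t} B' \<le> 1 / exp 1"
      using B' B'_integral assms(1,12) s by auto
    have "\<forall>T. B' integrable_on {s..T}" using B'_int by blast
    with 1 2 trajectory_cong[OF x s(1)] show ?thesis
      by (intro bound[rule_format, OF _ s(2)] conjI)
  qed
  have init: "\<And>r. r \<le> \<sigma> \<Longrightarrow> \<bar>x r\<bar> \<le> (SUP r\<in>{..\<sigma>}. \<bar>\<phi> r\<bar> + (if r < \<sigma> then \<bar>\<psi> r\<bar> else 0))"
    "AE r in lebesgue. r < \<sigma> \<longrightarrow>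
      \<bar>neutral_deriv \<sigma> \<psi> x r\<bar> \<le> (SUP r\<in>{..\<sigma>}. \<bar>\<phi> r\<bar> + (if r < \<sigma> then \<bar>\<psi> r\<bar> else 0))"
    if "initial_data \<sigma> \<phi> \<psi>" "solution a b g h \<sigma> \<phi> \<psi> x" for \<sigma> \<phi> \<psi> x
    using initial_data_le_SUP[OF that(1)] that(2)
    by (auto simp: solution_def neutral_deriv_def)
  have from_t0: "\<bar>x t\<bar> \<le> C * exp (- \<nu> * (t - \<sigma>)) * (SUP r\<in>{..\<sigma>}. \<bar>\<phi> r\<bar> + (if r < \<sigma> then \<bar>\<psi> r\<bar> else 0))"
    if "initial_data \<sigma> \<phi> \<psi>" "solution a b g h \<sigma> \<phi> \<psi> x" "t\<^sub>0 \<le> \<sigma>" "\<sigma> \<le> t" for \<sigma> \<phi> \<psi> x t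
    using decay[OF trajectory[OF that(2) order_refl _ init[OF that(1,2)]] that(3,4)] that(3) assms(1)
    by (simp add: mult_ac)
  have "exponentially_stable_from t\<^sub>0 a b g h"
    unfolding exponentially_stable_from_def
    by (rule exI[of _ C], rule conjI[OF \<open>0 < C\<close>], rule exI[of _ \<nu>], rule conjI[OF \<open>0 < \<nu>\<close>],
        intro allI impI, erule conjE, rule from_t0)
  moreover have "exponentially_stable_from 0 a b g h" if a0: "ess_norm 0 a \<le> ereal a\<^sub>0"
  proof -
    have "ereal 0 \<le> ereal a\<^sub>0" using nonneg[of 0 a] a0 unfolding zero_ereal_def by (rule order_trans)
    then have "0 \<le> a\<^sub>0" by simp
    obtain C\<^sub>1 where "1 \<le> C\<^sub>1" and growth: "\<forall>\<sigma> a b g h x d M T.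
        neutral_trajectory \<sigma> a b g h x d M \<and> \<sigma> \<le> T \<and> T \<le> \<sigma> + t\<^sub>0 \<and>
        (AE t in lebesgue. \<sigma> \<le> t \<longrightarrow> \<bar>a t\<bar> \<le> a\<^sub>0 \<and> \<bar>b t\<bar> \<le> \<beta>\<^sub>0) \<longrightarrow>
        (\<forall>t\<le>T. \<bar>x t\<bar> \<le> C\<^sub>1 * M) \<and> (AE s in lebesgue. s \<le> T \<longrightarrow> \<bar>d s\<bar> \<le> C\<^sub>1 * M)"
      using neutral_delay_growth_bound[OF \<open>0 \<le> a\<^sub>0\<close> assms(9) \<beta>\<^sub>0(2) assms(1)] by (elim exE conjE)
    \<comment> \<open>\<open>C\<^sub>1\<close> carries the data to \<open>t\<^sub>0\<close>,
      \<open>C + 1\<close> covers times on either side of \<open>t\<^sub>0\<close>, and the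
      exponential pays for starting the decay at \<open>t\<^sub>0\<close> instead of \<sigma> \<ge>
      0.\<close>
    define C\<^sub>2 where "C\<^sub>2 = (C + 1) * C\<^sub>1 * exp (\<nu> * t\<^sub>0)"
    have e0: "1 \<le> exp (\<nu> * t\<^sub>0)" using \<open>0 < \<nu>\<close> assms(1) by simp
    have "0 < C\<^sub>2" using \<open>0 < C\<close> \<open>1 \<le> C\<^sub>1\<close> by (simp add: C\<^sub>2_def)
    have "C * 1 * 1 \<le> C\<^sub>2"
      unfolding C\<^sub>2_def using \<open>0 < C\<close> \<open>1 \<le> C\<^sub>1\<close> e0 by (intro mult_mono) auto
    have from_0: "\<bar>x t\<bar> \<le> C\<^sub>2 * exp (- \<nu> * (t - \<sigma>)) * (SUP r\<in>{..\<sigma>}. \<bar>\<phi> r\<bar> + (if r < \<sigma> then \<bar>\<psi> r\<bar> else 0))"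
      if "initial_data \<sigma> \<phi> \<psi>" and sol: "solution a b g h \<sigma> \<phi> \<psi> x" and "0 \<le> \<sigma>" "\<sigma> \<le> t" for \<sigma> \<phi> \<psi> x t
    proof -
      define M where "M = (SUP r\<in>{..\<sigma>}. \<bar>\<phi> r\<bar> + (if r < \<sigma> then \<bar>\<psi> r\<bar> else 0))"
      note init = init[OF that(1,2), folded M_def]
      have "0 \<le> M" using init(1)[of \<sigma>] by simp
      have shift: "exp (- \<nu> * (t - s)) \<le> exp (\<nu> * t\<^sub>0) * exp (- \<nu> * (t - \<sigma>))" if "s \<le> t\<^sub>0" for s
      proof -
        have "\<nu> * s \<le> \<nu> * (t\<^sub>0 + \<sigma>)" using that \<open>0 < \<nu>\<close> \<open>0 \<le> \<sigma>\<close> by (intro mult_left_mono) auto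
        then show ?thesis by (simp add: exp_add[symmetric] algebra_simps)
      qed
      have "\<bar>x t\<bar> \<le> C\<^sub>2 * exp (- \<nu> * (t - \<sigma>)) * M"
      proof (cases "t\<^sub>0 \<le> \<sigma>")
        case True
        then have "\<bar>x t\<bar> \<le> C * exp (- \<nu> * (t - \<sigma>)) * M" unfolding M_def by (intro from_t0 that)
        also have "\<dots> \<le> C\<^sub>2 * exp (- \<nu> * (t - \<sigma>)) * M"
          using \<open>C * 1 * 1 \<le> C\<^sub>2\<close> \<open>0 \<le> M\<close> by (intro mult_right_mono) auto
        finally show ?thesis .
      next
        case False
        have G: "(\<forall>t\<le>t\<^sub>0. \<bar>x t\<bar> \<le> C\<^sub>1 * M) \<and> (AE s in lebesgue. s \<le> t\<^sub>0 \<longrightarrow> \<bar>neutral_deriv \<sigma> \<psi> x s\<bar> \<le> C\<^sub>1 * M)"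
        proof (rule growth[rule_format], intro conjI)
          show "neutral_trajectory \<sigma> a b g h x (neutral_deriv \<sigma> \<psi> x) M"
            by (rule trajectory[OF sol order_refl \<open>0 \<le> \<sigma>\<close> init])
          show "AE t in lebesgue. \<sigma> \<le> t \<longrightarrow> \<bar>a t\<bar> \<le> a\<^sub>0 \<and> \<bar>b t\<bar> \<le> \<beta>\<^sub>0"
            using bAE AE_ess_norm[OF a0] by eventually_elim (use \<open>0 \<le> \<sigma>\<close> in auto)
        qed (use False \<open>0 \<le> \<sigma>\<close> in auto)
        have "\<bar>x t\<bar> \<le> (C + 1) * (C\<^sub>1 * M) * (exp (\<nu> * t\<^sub>0) * exp (- \<nu> * (t - \<sigma>)))"
        proof (cases "t\<^sub>0 \<le> t")
          case True
          have "AE r in lebesgue. r < t\<^sub>0 \<longrightarrow> \<bar>neutral_deriv \<sigma> \<psi> x r\<bar> \<le> C\<^sub>1 * M"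
            using G by (auto elim: eventually_mono)
          then have "\<bar>x t\<bar> \<le> C * (C\<^sub>1 * M) * exp (- \<nu> * (t - t\<^sub>0))"
            using G False True assms(1) by (intro decay[OF trajectory[OF sol]]) auto
          also have "\<dots> \<le> (C + 1) * (C\<^sub>1 * M) * (exp (\<nu> * t\<^sub>0) * exp (- \<nu> * (t - \<sigma>)))"
            using shift[of t\<^sub>0] \<open>0 < C\<close> \<open>1 \<le> C\<^sub>1\<close> \<open>0 \<le> M\<close> by (intro mult_mono) auto
          finally show ?thesis .
        next
          case t: False
          \<comment> \<open>The factor \<open>exp (- \<nu> * (t - t))\<close> is 1, written so that
            \<open>shift\<close> applies with \<open>s = t\<close>.\<close>
          then have "\<bar>x t\<bar> \<le> 1 * (C\<^sub>1 * M) * exp (- \<nu> * (t - t))" using G by auto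
          also have "\<dots> \<le> (C + 1) * (C\<^sub>1 * M) * (exp (\<nu> * t\<^sub>0) * exp (- \<nu> * (t - \<sigma>)))"
            using shift[of t] t \<open>0 < C\<close> \<open>1 \<le> C\<^sub>1\<close> \<open>0 \<le> M\<close> by (intro mult_mono) auto
          finally show ?thesis .
        qed
        then show ?thesis by (simp add: C\<^sub>2_def mult_ac)
      qed
      then show ?thesis unfolding M_def .
    qed
    show ?thesis
      unfolding exponentially_stable_from_def
    by (rule exI[of _ C\<^sub>2], rule conjI[OF \<open>0 < C\<^sub>2\<close>], rule exI[of _ \<nu>], rule conjI[OF \<open>0 < \<nu>\<close>],
        intro allI impI, erule conjE, rule from_0)
  qed
  ultimately show ?thesis by blast
qed

end
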